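(* For all positive integers $m$ and $n$, $$S_{m,n}(\mathbf{x};y,q)=C_{m,n}(\mathbf{x}+y;q),$$ and, for every integer $k$ with $0\leq k\leq n$, $$S_{m,n}^{(k)}(q)=\left\langle C_{m,n}(\mathbf{x};q),\,e_{n-k}(\mathbf{x})\,h_k(\mathbf{x})\right\rangle.$$
   Context: For positive integers $m,n$, an $(m,n)$-Schröder path is a sequence of points $(u,v)\in\mathbb{N}\times\mathbb{N}$ starting at $(0,0)$ and ending at $(m,n)$, all satisfying $mv-nu\geq 0$, in which each next point is obtained by adding $(0,1)$ (up step), $(1,1)$ (diagonal step) or $(1,0)$ (right step). For such a path $\alpha$, $\mathrm{diag}(\alpha)$ is the number of its diagonal steps, and $\gamma(\alpha)$ is the list of the lengths of its risers, i.e. of its maximal sequences of consecutive up steps. The weight of $\alpha$ is $\alpha(\mathbf{x}):=\prod_{k\in\gamma(\alpha)}e_k(\mathbf{x})$ (product with multiplicity, equal to $1$ if there is no riser). Area: for $0\leq i\leq n-1$ let $|a_i|$ be the $x$-coordinate of the starting point of the unique up or diagonal step of $\alpha$ that goes from height $i$ to height $i+1$ (the number of entire unit cells to the left of that step in its row). Set $\mathrm{area}_i(\alpha):=\lfloor i\,m/n\rfloor-|a_i|$ and $\mathrm{area}(\alpha):=\sum_{i=0}^{n-1}\mathrm{area}_i(\alpha)$. Enumerators (sums over $(m,n)$-Schröder paths $\alpha$, subject to the indicated condition): $$S_{m,n}(\mathbf{x};y,q):=\sum_{\alpha}\alpha(\mathbf{x})\,q^{\mathrm{area}(\alpha)}y^{\mathrm{diag}(\alpha)},\qquad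 S_{m,n}^{(k)}(q):=\sum_{\mathrm{diag}(\alpha)=k}q^{\mathrm{area}(\alpha)},\qquad C_{m,n}(\mathbf{x};q):=\sum_{\mathrm{diag}(\alpha)=0}\alpha(\mathbf{x})\,q^{\mathrm{area}(\alpha)}.$$ Here $e_k$, $h_k$, $p_k$ are the elementary, complete homogeneous and power sum symmetric functions in $\mathbf{x}=x_1,x_2,\ldots$ (with $e_0=h_0=1$). For a symmetric function $f$ (with coefficients in $\mathbb{Q}[q]$), $f(\mathbf{x}+y)$ denotes $f$ evaluated on the variables $\mathbf{x}$ enlarged by one new variable $y$, and $C_{m,n}(\mathbf{x}+y;q)$ is obtained in this way from $C_{m,n}(\mathbf{x};q)$. The scalar product is the usual (Hall) one, extended $\mathbb{Q}[q]$-linearly: $\langle p_\mu,p_\nu\rangle=z_\mu\,\delta_{\mu,\nu}$, where $z_\mu=\prod_i i^{d_i}d_i!$ with $d_i$ the number of parts of $\mu$ equal to $i$. *)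

theory Defs
  imports "HOL-Library.Multiset" "HOL-Library.Product_Plus"
    "HOL-Computational_Algebra.Polynomial"
begin

text \<open>
  The monomial \<open>x\<^bsub>i\<^sub>1\<^esub> \<cdots> x\<^bsub>i\<^sub>r\<^esub>\<close> in the variables \<open>x\<^sub>0, x\<^sub>1, \<dots>\<close> is encoded as the multiset
  \<open>{#i\<^sub>1, \<dots>, i\<^sub>r#}\<close> of its indices. A symmetric function is the family of coefficients of a formal
  series of bounded degree that is invariant under all permutations of the variables.
\<close>

typedef (overloaded) 'a::zero symfun =
  "{f :: nat multiset \<Rightarrow> 'a. (\<forall>\<sigma> M. bij \<sigma> \<longrightarrow> f (image_mset \<sigma> M) = f M) \<and>
     (\<exists>d. \<forall>M. f M \<noteq> 0 \<longrightarrow> size M \<le> d)}"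
  morphisms symcoeff Abs_symfun
  by (rule exI [of _ "\<lambda>_. 0"]) auto

setup_lifting type_definition_symfun

lemma symfun_eqI: "(\<And>M. symcoeff f M = symcoeff g M) \<Longrightarrow> f = g"
  by (simp add: symcoeff_inject [symmetric] fun_eq_iff)

lemma finite_mset_decompositions: "finite {(A, B). A + B = (M :: 'b multiset)}"
proof -
  have "finite ((\<lambda>(xs, ys). (mset xs, mset ys)) `
      ({xs. set xs \<subseteq> set_mset M \<and> length xs \<le> size M} \<times>
       {xs. set xs \<subseteq> set_mset M \<and> length xs \<le> size M}))"
    by (intro finite_imageI finite_cartesian_product finite_lists_length_le) auto
  moreover have "{(A, B). A + B = M} \<subseteq> \<dots>"
  proof clarify
    fix A B assume M: "M = A + B"
    obtain xs ys where "A = mset xs" "B = mset ys" by (metis ex_mset)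
    then show "(A, B) \<in> (\<lambda>(xs, ys). (mset xs, mset ys)) `
      ({xs. set xs \<subseteq> set_mset (A + B) \<and> length xs \<le> size (A + B)} \<times>
       {xs. set xs \<subseteq> set_mset (A + B) \<and> length xs \<le> size (A + B)})"
      by (intro image_eqI [of _ _ "(xs, ys)"]) auto
  qed
  ultimately show ?thesis by (rule finite_subset [rotated])
qed

instantiation symfun :: (zero) zero
begin
lift_definition zero_symfun :: "'a symfun" is "\<lambda>_. 0" by auto
instance ..
end

instantiation symfun :: (zero_neq_one) one
begin
lift_definition one_symfun :: "'a symfun" is "\<lambda>M. if M = {#} then 1 else 0" by auto
instance ..
end

instantiation symfun :: (comm_monoid_add) comm_monoid_add
begin
lift_definition plus_symfun :: "'a symfun \<Rightarrow> 'a symfun \<Rightarrow> 'a symfun" is "\<lambda>f g M. f M + g M"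
proof clarify
  fix f g :: "nat multiset \<Rightarrow> 'a" and d e
  assume "\<forall>M. f M \<noteq> 0 \<longrightarrow> size M \<le> d" "\<forall>M. g M \<noteq> 0 \<longrightarrow> size M \<le> e"
  then have "\<forall>M. f M + g M \<noteq> 0 \<longrightarrow> size M \<le> max d e"
    by (metis add_0 max.coboundedI1 max.coboundedI2)
  moreover assume "\<forall>\<sigma> M. bij \<sigma> \<longrightarrow> f (image_mset \<sigma> M) = f M"
    "\<forall>\<sigma> M. bij \<sigma> \<longrightarrow> g (image_mset \<sigma> M) = g M"
  ultimately show "(\<forall>\<sigma> M. bij \<sigma> \<longrightarrow> f (image_mset \<sigma> M) + g (image_mset \<sigma> M) = f M + g M) \<and>
      (\<exists>d. \<forall>M. f M + g M \<noteq> 0 \<longrightarrow> size M \<le> d)"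
    by auto
qed
instance by standard (transfer; simp add: ac_simps fun_eq_iff)+
end

instantiation symfun :: (ab_group_add) ab_group_add
begin
lift_definition uminus_symfun :: "'a symfun \<Rightarrow> 'a symfun" is "\<lambda>f M. - f M" by auto
definition minus_symfun :: "'a symfun \<Rightarrow> 'a symfun \<Rightarrow> 'a symfun" where
  "minus_symfun f g = f + (- g)"
instance
proof
  fix f g :: "'a symfun"
  show "- f + f = 0" by transfer simp
  show "f - g = f + (- g)" by (rule minus_symfun_def)
qed
end

instantiation symfun :: (comm_ring_1) comm_ring_1
begin

lift_definition times_symfun :: "'a symfun \<Rightarrow> 'a symfun \<Rightarrow> 'a symfun" is
  "\<lambda>f g M. \<Sum>(A, B) | A + B = M. f A * g B"
proof clarify
  fix f g :: "nat multiset \<Rightarrow> 'a" and d e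
  assume bound: "\<forall>M. f M \<noteq> 0 \<longrightarrow> size M \<le> d" "\<forall>M. g M \<noteq> 0 \<longrightarrow> size M \<le> e"
    and sym: "\<forall>\<sigma> M. bij \<sigma> \<longrightarrow> f (image_mset \<sigma> M) = f M"
      "\<forall>\<sigma> M. bij \<sigma> \<longrightarrow> g (image_mset \<sigma> M) = g M"
  have "(\<Sum>(A, B) | A + B = M. f A * g B) = 0" if "\<not> size M \<le> d + e" for M
  proof (rule sum.neutral, clarify)
    fix A B assume "M = A + B"
    with that have "\<not> size A \<le> d \<or> \<not> size B \<le> e" by auto
    with bound show "f A * g B = 0" by (metis mult_zero_left mult_zero_right)
  qed
  moreover have "(\<Sum>(A, B) | A + B = image_mset \<sigma> M. f A * g B) = (\<Sum>(A, B) | A + B = M. f A * g B)"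
    if "bij \<sigma>" for \<sigma> M
  proof (rule sum.reindex_bij_witness
      [where i = "map_prod (image_mset \<sigma>) (image_mset \<sigma>)"
         and j = "map_prod (image_mset (inv \<sigma>)) (image_mset (inv \<sigma>))"])
    have inv: "image_mset \<sigma> (image_mset (inv \<sigma>) A) = A" "image_mset (inv \<sigma>) (image_mset \<sigma> A) = A" for A
      using that by (simp_all add: multiset.map_comp comp_def bij_is_surj surj_f_inv_f bij_is_inj)
    show "map_prod (image_mset (inv \<sigma>)) (image_mset (inv \<sigma>)) P \<in> {(A, B). A + B = M}"
      if "P \<in> {(A, B). A + B = image_mset \<sigma> M}" for P
      using that by (auto simp: inv simp flip: image_mset_union)
    have "bij (inv \<sigma>)" using that by (rule bij_imp_bij_inv)
    with sym show "(case map_prod (image_mset (inv \<sigma>)) (image_mset (inv \<sigma>)) P of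
        (A, B) \<Rightarrow> f A * g B) = (case P of (A, B) \<Rightarrow> f A * g B)" for P
      by (auto split: prod.splits)
  qed (auto simp: multiset.map_comp comp_def that bij_is_surj surj_f_inv_f bij_is_inj)
  ultimately show "(\<forall>\<sigma> M. bij \<sigma> \<longrightarrow>
        (\<Sum>(A, B) | A + B = image_mset \<sigma> M. f A * g B) = (\<Sum>(A, B) | A + B = M. f A * g B)) \<and>
      (\<exists>d. \<forall>M. (\<Sum>(A, B) | A + B = M. f A * g B) \<noteq> 0 \<longrightarrow> size M \<le> d)"
    by blast
qed

instance
proof
  fix f g h :: "'a symfun"
  show "f * g * h = f * (g * h)"
  proof transfer
    fix f g h :: "nat multiset \<Rightarrow> 'a"
    show "(\<lambda>M. \<Sum>(A, B) | A + B = M. (\<Sum>(C, D) | C + D = A. f C * g D) * h B) =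
      (\<lambda>M. \<Sum>(A, B) | A + B = M. f A * (\<Sum>(C, D) | C + D = B. g C * h D))"
    proof
      fix M
      let ?D = "\<lambda>M. {(A, B). A + B = (M :: nat multiset)}"
      have "(\<Sum>(A, B)\<in>?D M. (\<Sum>(C, D)\<in>?D A. f C * g D) * h B) =
          (\<Sum>(P, Q)\<in>Sigma (?D M) (\<lambda>P. ?D (fst P)). f (fst Q) * g (snd Q) * h (snd P))"
        by (simp add: sum_distrib_right case_prod_unfold
            sum.Sigma finite_mset_decompositions [unfolded case_prod_unfold])
      also have "\<dots> =
          (\<Sum>(P, Q)\<in>Sigma (?D M) (\<lambda>P. ?D (snd P)). f (fst P) * (g (fst Q) * h (snd Q)))"
        by (rule sum.reindex_bij_witness
            [where i = "\<lambda>((A, _), (B, C)). ((A + B, C), (A, B))"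
               and j = "\<lambda>((_, C), (A, B)). ((A, B + C), (B, C))"])
          (auto simp: ac_simps)
      also have "\<dots> = (\<Sum>(A, B)\<in>?D M. f A * (\<Sum>(C, D)\<in>?D B. g C * h D))"
        by (simp add: sum_distrib_left case_prod_unfold
            sum.Sigma finite_mset_decompositions [unfolded case_prod_unfold])
      finally show "(\<Sum>(A, B)\<in>?D M. (\<Sum>(C, D)\<in>?D A. f C * g D) * h B) =
          (\<Sum>(A, B)\<in>?D M. f A * (\<Sum>(C, D)\<in>?D B. g C * h D))" .
    qed
  qed
  show "f * g = g * f"
  proof (transfer, rule ext)
    fix f g :: "nat multiset \<Rightarrow> 'a" and M
    show "(\<Sum>(A, B) | A + B = M. f A * g B) = (\<Sum>(A, B) | A + B = M. g A * f B)"
      by (rule sum.reindex_bij_witness [where i = prod.swap and j = prod.swap])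
        (auto simp: ac_simps)
  qed
  show "1 * f = f"
  proof (transfer, rule ext)
    fix f :: "nat multiset \<Rightarrow> 'a" and M
    have "(\<Sum>(A, B) | A + B = M. (if A = {#} then 1 else 0) * f B) =
        (\<Sum>(A, B) \<in> {({#} :: nat multiset, M)}. (if A = {#} then 1 else 0) * f B)"
      by (rule sum.mono_neutral_right) (auto simp: finite_mset_decompositions split: if_splits)
    then show "(\<Sum>(A, B) | A + B = M. (if A = {#} then 1 else 0) * f B) = f M" by simp
  qed
  show "(f + g) * h = f * h + g * h"
    by transfer (simp add: fun_eq_iff algebra_simps sum.distrib case_prod_unfold)
  show "(0 :: 'a symfun) \<noteq> 1"
    by transfer (auto simp: fun_eq_iff)
qed

end

lift_definition scale :: "'a::comm_ring_1 \<Rightarrow> 'a symfun \<Rightarrow> 'a symfun" is "\<lambda>c f M. c * f M"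
proof clarify
  fix c :: 'a and f :: "nat multiset \<Rightarrow> 'a" and d
  assume "\<forall>M. f M \<noteq> 0 \<longrightarrow> size M \<le> d"
    and sym: "\<forall>\<sigma> M. bij \<sigma> \<longrightarrow> f (image_mset \<sigma> M) = f M"
  then have "\<forall>M. c * f M \<noteq> 0 \<longrightarrow> size M \<le> d" by (metis mult_zero_right)
  with sym show "(\<forall>\<sigma> M. bij \<sigma> \<longrightarrow> c * f (image_mset \<sigma> M) = c * f M) \<and>
      (\<exists>d. \<forall>M. c * f M \<noteq> 0 \<longrightarrow> size M \<le> d)"
    by auto
qed

text \<open>
  \<open>elementary k\<close> is the sum of the squarefree monomials of degree \<open>k\<close>, \<open>homogeneous k\<close> the sum of
  all monomials of degree \<open>k\<close>, and \<open>power_sum k\<close> (for \<open>k > 0\<close>) the sum of the \<open>x\<^sub>i\<^sup>k\<close>.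
\<close>

lift_definition elementary :: "nat \<Rightarrow> 'a::zero_neq_one symfun" is
  "\<lambda>k M. if size M = k \<and> (\<forall>i. count M i \<le> 1) then 1 else 0"
proof (intro CollectI conjI allI impI)
  fix k and \<sigma> :: "nat \<Rightarrow> nat" and M assume "bij \<sigma>"
  then have "count (image_mset \<sigma> M) (\<sigma> i) = count M i" for i
    by (induction M) (auto dest: bij_is_inj simp: inj_eq)
  with \<open>bij \<sigma>\<close> have "(\<forall>i. count (image_mset \<sigma> M) i \<le> 1) \<longleftrightarrow> (\<forall>i. count M i \<le> 1)"
    by (metis bij_pointE)
  then show "(if size (image_mset \<sigma> M) = k \<and> (\<forall>i. count (image_mset \<sigma> M) i \<le> 1) then 1 else 0) =
      (if size M = k \<and> (\<forall>i. count M i \<le> 1) then 1 else (0 :: 'a))"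
    by simp
qed auto

lift_definition homogeneous :: "nat \<Rightarrow> 'a::zero_neq_one symfun" is
  "\<lambda>k M. if size M = k then 1 else 0"
  by auto

lift_definition power_sum :: "nat \<Rightarrow> 'a::zero_neq_one symfun" is
  "\<lambda>k M. if \<exists>i. M = replicate_mset k i then 1 else 0"
proof (intro CollectI conjI allI impI)
  fix k and \<sigma> :: "nat \<Rightarrow> nat" and M assume "bij \<sigma>"
  have "(\<exists>i. image_mset \<sigma> M = replicate_mset k i) \<longleftrightarrow> (\<exists>i. M = replicate_mset k i)"
  proof
    assume "\<exists>i. image_mset \<sigma> M = replicate_mset k i"
    then obtain i where "image_mset \<sigma> M = replicate_mset k i" ..
    then have "image_mset (inv \<sigma>) (image_mset \<sigma> M) = replicate_mset k (inv \<sigma> i)" by simp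
    with \<open>bij \<sigma>\<close> show "\<exists>i. M = replicate_mset k i"
      by (auto simp: multiset.map_comp comp_def bij_is_inj)
  qed auto
  then show "(if \<exists>i. image_mset \<sigma> M = replicate_mset k i then 1 else 0) =
      (if \<exists>i. M = replicate_mset k i then 1 else (0 :: 'a))"
    by simp
qed (auto intro!: exI)

text \<open>
  \<open>add_variable f\<close> is \<open>f(\<^bold>x + y)\<close>, with coefficients that are polynomials in \<open>y\<close>. Since \<open>f\<close> is
  symmetric it may be evaluated at \<open>y, x\<^sub>0, x\<^sub>1, \<dots>\<close> in this order: the old variable \<open>0\<close> becomes \<open>y\<close>
  and the old variable \<open>i + 1\<close> becomes \<open>x\<^sub>i\<close>.
\<close>

lift_definition add_variable :: "'a::zero symfun \<Rightarrow> 'a poly symfun" is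
  "\<lambda>f M. Abs_poly (\<lambda>j. f (image_mset Suc M + replicate_mset j 0))"
proof clarify
  fix f :: "nat multiset \<Rightarrow> 'a" and d
  assume bound: "\<forall>M. f M \<noteq> 0 \<longrightarrow> size M \<le> d"
    and sym: "\<forall>\<sigma> M. bij \<sigma> \<longrightarrow> f (image_mset \<sigma> M) = f M"
  have 1: "f (image_mset Suc (image_mset \<sigma> M) + replicate_mset j 0) =
      f (image_mset Suc M + replicate_mset j 0)" if "bij \<sigma>" for \<sigma> M j
  proof -
    define \<tau> where "\<tau> = case_nat 0 (\<lambda>i. Suc (\<sigma> i))"
    have "bij \<tau>"
    proof (rule o_bij)
      show "case_nat 0 (\<lambda>i. Suc (inv \<sigma> i)) \<circ> \<tau> = id" "\<tau> \<circ> case_nat 0 (\<lambda>i. Suc (inv \<sigma> i)) = id"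
        using that by (auto simp: fun_eq_iff \<tau>_def bij_is_inj bij_is_surj surj_f_inv_f
            split: nat.splits)
    qed
    moreover have "image_mset \<tau> (image_mset Suc M + replicate_mset j 0) =
        image_mset Suc (image_mset \<sigma> M) + replicate_mset j 0"
      by (simp add: multiset.map_comp comp_def \<tau>_def)
    ultimately show ?thesis using sym by metis
  qed
  have 2: "Abs_poly (\<lambda>j. f (image_mset Suc M + replicate_mset j 0)) = 0"
    if "\<not> size M \<le> d" for M
  proof -
    have "f (image_mset Suc M + replicate_mset j 0) = 0" for j
      using bound that by (metis le_add1 le_trans size_image_mset size_union)
    then show ?thesis by (simp add: zero_poly.abs_eq)
  qed
  from 1 show "(\<forall>\<sigma> M. bij \<sigma> \<longrightarrow>
        Abs_poly (\<lambda>j. f (image_mset Suc (image_mset \<sigma> M) + replicate_mset j 0)) =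
        Abs_poly (\<lambda>j. f (image_mset Suc M + replicate_mset j 0))) \<and>
      (\<exists>d. \<forall>M. Abs_poly (\<lambda>j. f (image_mset Suc M + replicate_mset j 0)) \<noteq> 0 \<longrightarrow> size M \<le> d)"
    by (intro conjI exI [of _ d]) (use 2 in auto)
qed

text \<open>
  Partitions are multisets of positive parts. The \<open>p\<^sub>\<mu>\<close> form a basis of the symmetric functions over
  \<open>\<rat>[q]\<close>, and the scalar product is computed from the coordinates in this basis.
\<close>

definition z_mset :: "nat multiset \<Rightarrow> nat" where
  "z_mset \<mu> = (\<Prod>i\<in>set_mset \<mu>. i ^ count \<mu> i * fact (count \<mu> i))"

definition power_sum_prod :: "nat multiset \<Rightarrow> 'a::comm_ring_1 symfun" where
  "power_sum_prod \<mu> = (\<Prod>i\<in>#\<mu>. power_sum i)"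

definition power_sum_coords :: "rat poly symfun \<Rightarrow> nat multiset \<Rightarrow> rat poly" where
  "power_sum_coords f = (THE c. finite {\<mu>. c \<mu> \<noteq> 0} \<and> (\<forall>\<mu>. c \<mu> \<noteq> 0 \<longrightarrow> 0 \<notin># \<mu>) \<and>
     f = (\<Sum>\<mu> | c \<mu> \<noteq> 0. scale (c \<mu>) (power_sum_prod \<mu>)))"

definition hall :: "rat poly symfun \<Rightarrow> rat poly symfun \<Rightarrow> rat poly" where
  "hall f g = (\<Sum>\<mu> | power_sum_coords f \<mu> \<noteq> 0.
     power_sum_coords f \<mu> * power_sum_coords g \<mu> * of_nat (z_mset \<mu>))"

definition schroeder_paths :: "nat \<Rightarrow> nat \<Rightarrow> (nat \<times> nat) list set" where
  "schroeder_paths m n = {\<alpha>. \<alpha> \<noteq> [] \<and> hd \<alpha> = (0, 0) \<and> last \<alpha> = (m, n) \<and>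
     (\<forall>(u, v) \<in> set \<alpha>. int m * int v - int n * int u \<ge> 0) \<and>
     successively (\<lambda>P Q. Q = P + (0, 1) \<or> Q = P + (1, 1) \<or> Q = P + (1, 0)) \<alpha>}"

definition segments :: "(nat \<times> nat) list \<Rightarrow> ((nat \<times> nat) \<times> (nat \<times> nat)) list" where
  "segments \<alpha> = zip \<alpha> (tl \<alpha>)"

definition is_up :: "(nat \<times> nat) \<times> (nat \<times> nat) \<Rightarrow> bool" where
  "is_up s \<longleftrightarrow> snd s = fst s + (0, 1)"

definition is_diag :: "(nat \<times> nat) \<times> (nat \<times> nat) \<Rightarrow> bool" where
  "is_diag s \<longleftrightarrow> snd s = fst s + (1, 1)"

definition diag :: "(nat \<times> nat) list \<Rightarrow> nat" where
  "diag \<alpha> = length (filter is_diag (segments \<alpha>))"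

text \<open>Lengths of the maximal blocks of consecutive \<open>True\<close> entries, from left to right.\<close>

function run_lengths :: "bool list \<Rightarrow> nat list" where
  "run_lengths [] = []"
| "run_lengths (False # bs) = run_lengths bs"
| "run_lengths (True # bs) =
     Suc (length (takeWhile (\<lambda>b. b) bs)) # run_lengths (dropWhile (\<lambda>b. b) bs)"
  by pat_completeness auto
termination
  by (relation "measure length") (auto simp: length_dropWhile_le less_Suc_eq_le)

definition risers :: "(nat \<times> nat) list \<Rightarrow> nat list" where
  "risers \<alpha> = run_lengths (map is_up (segments \<alpha>))"

definition weight :: "(nat \<times> nat) list \<Rightarrow> 'a::comm_ring_1 symfun" where
  "weight \<alpha> = (\<Prod>k\<leftarrow>risers \<alpha>. elementary k)"

definition row_start :: "(nat \<times> nat) list \<Rightarrow> nat \<Rightarrow> nat" where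
  "row_start \<alpha> i = (THE u. \<exists>u'. ((u, i), (u', Suc i)) \<in> set (segments \<alpha>))"

definition area :: "nat \<Rightarrow> nat \<Rightarrow> (nat \<times> nat) list \<Rightarrow> int" where
  "area m n \<alpha> = (\<Sum>i<n. \<lfloor>of_nat (i * m) / (of_nat n :: rat)\<rfloor> - int (row_start \<alpha> i))"

text \<open>
  Coefficients lie in \<open>\<rat>[q]\<close>, rendered as \<^typ>\<open>rat poly\<close>, or in \<open>\<rat>[q][y]\<close>, rendered as
  \<^typ>\<open>rat poly poly\<close> with \<open>y\<close> as the outer indeterminate. Every summand of the area of a path is
  nonnegative, so the conversion of the exponent of \<open>q\<close> to a natural number loses nothing.
\<close>

definition schroeder_enum :: "nat \<Rightarrow> nat \<Rightarrow> rat poly poly symfun" where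
  "schroeder_enum m n = (\<Sum>\<alpha>\<in>schroeder_paths m n.
     scale (monom (monom 1 (nat (area m n \<alpha>))) (diag \<alpha>)) (weight \<alpha>))"

definition schroeder_diag_enum :: "nat \<Rightarrow> nat \<Rightarrow> nat \<Rightarrow> rat poly" where
  "schroeder_diag_enum m n k =
     (\<Sum>\<alpha> | \<alpha> \<in> schroeder_paths m n \<and> diag \<alpha> = k. monom 1 (nat (area m n \<alpha>)))"

definition dyck_enum :: "nat \<Rightarrow> nat \<Rightarrow> rat poly symfun" where
  "dyck_enum m n = (\<Sum>\<alpha> | \<alpha> \<in> schroeder_paths m n \<and> diag \<alpha> = 0.
     scale (monom 1 (nat (area m n \<alpha>))) (weight \<alpha>))"

end

theory Submission
  imports Defs
begin

text \<open>
  A path without diagonal steps never ends with an up step, so each of its risers is followed by a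
  right step. Replacing the last up step of a riser and this right step by a diagonal step shortens
  the riser by one and changes neither the starting points of the rows nor, therefore, the area.
  Every Schroeder path arises exactly once from a path without diagonal steps and a subset of its
  risers. Hence, for arbitrary riser weights \<open>f\<close> with \<open>f 0 = 1\<close>, summing \<open>y\<^bsup>diag\<^esup> \<Prod> f k\<close> over all
  Schroeder paths is the same as summing \<open>\<Prod> (f k + y f (k - 1))\<close> over those without diagonal steps
  (\<open>schroeder_sum_eq_dyck_sum\<close>). The proof does not construct the bijection: it compares the
  recursions that both sums satisfy when the starting point of the paths varies and some up steps
  may already precede it (\<open>path_sum_absorb_diagonals\<close>).

  For \<open>f k = e\<^sub>k\<close> the new weight is \<open>e\<^sub>k + y e\<^bsub>k-1\<^esub> = e\<^sub>k(\<^bold>x + y)\<close>, and since \<open>f \<mapsto> f(\<^bold>x + y)\<close> is a ring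
  homomorphism this is the first identity.

  For the second identity, the pairing of a symmetric function of degree \<open>n\<close> with \<open>e\<^bsub>n-k\<^esub> h\<^sub>k\<close> is the
  coefficient of \<open>t\<^sup>k\<close> in its image under the ring homomorphism \<open>p\<^sub>i \<mapsto> t\<^sup>i - (-1)\<^sup>i\<close>
  (\<open>hall_elem_hom\<close>). Indeed, by the Newton identities the coordinate of \<open>e\<^bsub>n-k\<^esub> h\<^sub>k\<close> at \<open>p\<^sub>\<mu>\<close> is
  \<open>z\<^sub>\<mu>\<^sup>-\<^sup>1\<close> times the coefficient of \<open>t\<^sup>k\<close> in \<open>\<Prod> (t\<^sup>i - (-1)\<^sup>i)\<close>, the product being over the parts of \<open>\<mu>\<close>
  (\<open>elem_hom_eq_kernel\<close>), and \<open>z\<^sub>\<mu>\<close> cancels in the scalar product. The homomorphism sends every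
  \<open>e\<^sub>r\<close> with \<open>r > 0\<close> to \<open>1 + t\<close> (\<open>specializes_elementary\<close>), so a path without diagonal steps
  contributes \<open>(1 + t)\<close> to the number of its risers. This is the sum over Schroeder paths obtained from
  the path identity with \<open>f k = 1\<close> and \<open>y = t\<close>.

  Coordinates with respect to the \<open>p\<^sub>\<mu>\<close> are meaningful because these products are linearly independent
  (\<open>power_sum_prods_independent\<close>).
\<close>

section \<open>Coefficients and scalars\<close>

lemma symcoeff_0 [simp]: "symcoeff 0 M = 0" by transfer simp

lemma symcoeff_1: "symcoeff 1 M = (if M = {#} then 1 else 0)" by transfer simp

lemma symcoeff_add [simp]: "symcoeff (f + g) M = symcoeff f M + symcoeff g M"
  by transfer simp

lemma symcoeff_sum: "symcoeff (\<Sum>a\<in>X. f a) M = (\<Sum>a\<in>X. symcoeff (f a) M)"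
  by (induction X rule: infinite_finite_induct) auto

lemma symcoeff_scale [simp]: "symcoeff (scale c f) M = c * symcoeff f M"
  by transfer simp

lemma symcoeff_mult:
  "symcoeff (f * g) M = (\<Sum>(A, B) | A + B = M. symcoeff f A * symcoeff g B)"
  by transfer simp

lemma symcoeff_elementary:
  "symcoeff (elementary k) M = (if size M = k \<and> (\<forall>i. count M i \<le> 1) then 1 else 0)"
  by transfer simp

lemma symcoeff_homogeneous: "symcoeff (homogeneous k) M = (if size M = k then 1 else 0)"
  by transfer simp

lemma symcoeff_power_sum:
  "symcoeff (power_sum k) M = (if \<exists>i. M = replicate_mset k i then 1 else 0)"
  by transfer simp

lemma scale_scale [simp]: "scale a (scale b f) = scale (a * b) f"
  by (rule symfun_eqI) (simp add: mult.assoc)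

lemma scale_1 [simp]: "scale 1 f = f"
  by (rule symfun_eqI) simp

lemma scale_0_left [simp]: "scale 0 f = 0"
  by (rule symfun_eqI) simp

lemma scale_0_right [simp]: "scale a 0 = 0"
  by (rule symfun_eqI) simp

lemma scale_add_right: "scale a (f + g) = scale a f + scale a g"
  by (rule symfun_eqI) (simp add: algebra_simps)

lemma scale_add_left: "scale (a + b) f = scale a f + scale b f"
  by (rule symfun_eqI) (simp add: algebra_simps)

lemma scale_sum_left: "scale (\<Sum>x\<in>X. a x) f = (\<Sum>x\<in>X. scale (a x) f)"
  by (rule symfun_eqI) (simp add: symcoeff_sum sum_distrib_right)

lemma scale_sum_right: "scale a (\<Sum>x\<in>X. f x) = (\<Sum>x\<in>X. scale a (f x))"
  by (rule symfun_eqI) (simp add: symcoeff_sum sum_distrib_left)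

lemma scale_mult_left [simp]: "scale a f * g = scale a (f * g)"
  by (rule symfun_eqI) (simp add: symcoeff_mult sum_distrib_left case_prod_unfold mult.assoc)

lemma scale_mult_right [simp]: "f * scale a g = scale a (f * g)"
  by (metis mult.commute scale_mult_left)

lemma scale_minus_left: "scale (- a) f = - scale a f"
  by (metis add.right_inverse add_eq_0_iff scale_0_left scale_add_left)

lemma scale_diff_left: "scale (a - b) f = scale a f - scale b f"
  by (simp only: diff_conv_add_uminus scale_add_left scale_minus_left)

lemma of_nat_mult_symfun: "of_nat n * f = scale (of_nat n) f"
  by (induction n) (simp_all add: scale_add_left algebra_simps)

lemma scale_power: "scale a f ^ n = scale (a ^ n) (f ^ n)"
  by (induction n) (simp_all add: mult.commute)

lemma elementary_0 [simp]: "elementary 0 = 1"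
  by (rule symfun_eqI) (auto simp: symcoeff_elementary symcoeff_1)

lemma homogeneous_0 [simp]: "homogeneous 0 = 1"
  by (rule symfun_eqI) (auto simp: symcoeff_homogeneous symcoeff_1)

lemma finite_count_ge: "i > 0 \<Longrightarrow> finite {j. i \<le> count M j}"
  by (rule finite_subset [of _ "set_mset M"]) (auto simp: count_greater_zero_iff [symmetric] simp del: count_greater_zero_iff)

text \<open>
  Since \<open>p\<^sub>i = \<Sum>\<^sub>j x\<^sub>j\<^sup>i\<close>, a monomial of \<open>p\<^sub>i f\<close> arises by choosing which \<open>x\<^sub>j\<^sup>i\<close> to split off. Both the
  Newton identities and the independence of the \<open>p\<^sub>\<mu>\<close> are read off from this formula.
\<close>

lemma symcoeff_power_sum_mult:
  assumes "i > 0"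
  shows "symcoeff (power_sum i * f) M =
    (\<Sum>j | i \<le> count M j. symcoeff f (M - replicate_mset i j))"
proof -
  let ?g = "\<lambda>j. (replicate_mset i j, M - replicate_mset i j)"
  have inj: "inj_on ?g {j. i \<le> count M j}"
    using assms by (auto simp: inj_on_def replicate_mset_eq_iff)
  have "symcoeff (power_sum i * f) M =
      (\<Sum>(A, B)\<in>?g ` {j. i \<le> count M j}. symcoeff (power_sum i) A * symcoeff f B)"
    unfolding symcoeff_mult
  proof (rule sum.mono_neutral_right)
    show "?g ` {j. i \<le> count M j} \<subseteq> {(A, B). A + B = M}"
      by (auto simp: count_le_replicate_mset_subset_eq subset_mset.add_diff_inverse)
    show "\<forall>P\<in>{(A, B). A + B = M} - ?g ` {j. i \<le> count M j}.
        (case P of (A, B) \<Rightarrow> symcoeff (power_sum i) A * symcoeff f B) = 0"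
      by (force simp: symcoeff_power_sum image_iff)
  qed (rule finite_mset_decompositions)
  also have "\<dots> = (\<Sum>j | i \<le> count M j. symcoeff f (M - replicate_mset i j))"
    using inj by (subst sum.reindex) (auto simp: symcoeff_power_sum intro!: sum.cong)
  finally show ?thesis .
qed

section \<open>Newton identities\<close>

text \<open>
  The right-hand side of a Newton identity, grouped by the variable \<open>x\<^sub>j\<close> from which a power is split
  off instead of by the exponent \<open>i\<close>. Both identities then reduce to a sum over \<open>i\<close> for fixed \<open>j\<close>.
\<close>

lemma symcoeff_sum_power_sum_mult:
  assumes deg: "\<And>i A. symcoeff (g i) A \<noteq> 0 \<Longrightarrow> size A = n - i"
  shows "symcoeff (\<Sum>i=1..n. scale (a i) (power_sum i * g i)) M =
    (if size M = n then
       \<Sum>j\<in>set_mset M. \<Sum>i=1..count M j. a i * symcoeff (g i) (M - replicate_mset i j)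
     else 0)"
proof -
  let ?t = "\<lambda>i j. a i * symcoeff (g i) (M - replicate_mset i j)"
  have "symcoeff (\<Sum>i=1..n. scale (a i) (power_sum i * g i)) M =
      (\<Sum>i=1..n. \<Sum>j | j \<in> set_mset M \<and> i \<le> count M j. ?t i j)"
    unfolding symcoeff_sum
  proof (rule sum.cong)
    fix i assume i: "i \<in> {1..n}"
    then have "{j. i \<le> count M j} = {j \<in> set_mset M. i \<le> count M j}"
      by (auto simp: count_greater_zero_iff [symmetric] simp del: count_greater_zero_iff)
    with i show "symcoeff (scale (a i) (power_sum i * g i)) M =
        (\<Sum>j | j \<in> set_mset M \<and> i \<le> count M j. ?t i j)"
      by (simp add: symcoeff_power_sum_mult sum_distrib_left)
  qed simp
  also have "\<dots> = (\<Sum>j\<in>set_mset M. \<Sum>i | i \<in> {1..n} \<and> i \<le> count M j. ?t i j)"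
    by (rule sum.swap_restrict) auto
  also have "\<dots> = (if size M = n then \<Sum>j\<in>set_mset M. \<Sum>i=1..count M j. ?t i j else 0)"
  proof (cases "size M = n")
    case True
    then have "{i \<in> {1..n}. i \<le> count M j} = {1..count M j}" for j
      using count_le_size [of M j] by auto
    with True show ?thesis by simp
  next
    case False
    have "?t i j = 0" if "i \<in> {1..n}" "i \<le> count M j" for i j
    proof -
      have "size (M - replicate_mset i j) = size M - i"
        using that by (simp add: size_Diff_submset count_le_replicate_mset_subset_eq)
      with False that count_le_size [of M j] have "size (M - replicate_mset i j) \<noteq> n - i"
        by auto
      then show ?thesis using deg by (metis mult_zero_right)
    qed
    with False show ?thesis by simp
  qed
  finally show ?thesis .
qed

lemma homogeneous_degree: "symcoeff (homogeneous k) A \<noteq> 0 \<Longrightarrow> size A = k"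
  by (simp add: symcoeff_homogeneous split: if_splits)

lemma elementary_degree: "symcoeff (elementary k) A \<noteq> 0 \<Longrightarrow> size A = k"
  by (simp add: symcoeff_elementary split: if_splits)

text \<open>
  Every variable \<open>x\<^sub>j\<close> contributes its exponent in the monomial, and the exponents add up to \<open>n\<close>.
\<close>

lemma newton_homogeneous:
  "of_nat n * homogeneous n =
    (\<Sum>i=1..n. power_sum i * homogeneous (n - i) :: 'a::comm_ring_1 symfun)"
proof (rule symfun_eqI)
  fix M :: "nat multiset"
  have *: "symcoeff (homogeneous (n - i)) (M - replicate_mset i j) = (1 :: 'a)"
    if "size M = n" "i \<in> {1..count M j}" for i j
    using that
    by (simp add: symcoeff_homogeneous size_Diff_submset count_le_replicate_mset_subset_eq)
  have "symcoeff (\<Sum>i=1..n. power_sum i * homogeneous (n - i) :: 'a symfun) M =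
      symcoeff (\<Sum>i=1..n. scale 1 (power_sum i * homogeneous (n - i)) :: 'a symfun) M"
    by simp
  also have "\<dots> = (if size M = n then of_nat (\<Sum>j\<in>set_mset M. count M j) else 0)"
    by (subst symcoeff_sum_power_sum_mult) (auto simp: * intro: homogeneous_degree)
  also have "\<dots> = symcoeff (of_nat n * homogeneous n :: 'a symfun) M"
    by (simp add: of_nat_mult_symfun symcoeff_homogeneous flip: size_multiset_overloaded_eq)
  finally show "symcoeff (of_nat n * homogeneous n :: 'a symfun) M =
    symcoeff (\<Sum>i=1..n. power_sum i * homogeneous (n - i)) M" ..
qed

text \<open>
  For a fixed variable \<open>x\<^sub>j\<close> with exponent at least \<open>2\<close> the two ways of leaving a squarefree monomial
  carry opposite signs. Hence only squarefree monomials survive, each with one term per variable.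
\<close>

lemma newton_elementary:
  "of_nat n * elementary n =
    (\<Sum>i=1..n. scale ((-1) ^ (i - 1)) (power_sum i * elementary (n - i)) :: 'a::comm_ring_1 symfun)"
proof (rule symfun_eqI)
  fix M :: "nat multiset"
  define sqfree where "sqfree A \<longleftrightarrow> (\<forall>i. count A i \<le> 1)" for A :: "nat multiset"
  have *: "(\<Sum>i=1..count M j. (-1) ^ (i - 1) *
      symcoeff (elementary (n - i)) (M - replicate_mset i j)) = (of_bool (sqfree M) :: 'a)"
    (is "?S = _") if n: "size M = n" and j: "j \<in># M" for j
  proof -
    define c where "c = count M j"
    define rest where "rest \<longleftrightarrow> (\<forall>i. i \<noteq> j \<longrightarrow> count M i \<le> 1)"
    have "?S = (\<Sum>i=1..c. (-1) ^ (i - 1) * of_bool (rest \<and> c - i \<le> 1))"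
      unfolding c_def
    proof (rule sum.cong)
      fix i assume i: "i \<in> {1..count M j}"
      have "sqfree (M - replicate_mset i j) \<longleftrightarrow> rest \<and> count M j - i \<le> 1"
        unfolding sqfree_def rest_def by (metis count_diff count_replicate_mset diff_zero)
      then show "(-1) ^ (i - 1) * symcoeff (elementary (n - i)) (M - replicate_mset i j) =
          (-1) ^ (i - 1) * (of_bool (rest \<and> count M j - i \<le> 1) :: 'a)"
        using i n
        by (simp add: symcoeff_elementary sqfree_def size_Diff_submset
            count_le_replicate_mset_subset_eq)
    qed simp
    also have "\<dots> = of_bool (rest \<and> c \<le> 1)"
    proof -
      have "c > 0" using j by (simp add: c_def)
      then consider "c = 1" | d where "c = Suc (Suc d)"
        by (metis One_nat_def gr0_implies_Suc not0_implies_Suc)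
      then show ?thesis
      proof cases
        case 2
        \<comment> \<open>only \<open>i = c - 1\<close> and \<open>i = c\<close> leave at most one factor \<open>x\<^sub>j\<close>, and their signs differ\<close>
        have "(\<Sum>i=1..c. (-1) ^ (i - 1) * of_bool (rest \<and> c - i \<le> 1)) =
            (\<Sum>i\<in>{Suc d, Suc (Suc d)}. (-1) ^ (i - 1) * (of_bool (rest \<and> c - i \<le> 1) :: 'a))"
          using 2 by (intro sum.mono_neutral_right) auto
        also have "\<dots> = of_bool (rest \<and> c \<le> 1)"
          using 2 by (cases rest) simp_all
        finally show ?thesis .
      qed simp
    qed
    also have "rest \<and> c \<le> 1 \<longleftrightarrow> sqfree M"
      unfolding rest_def c_def sqfree_def by metis
    finally show ?thesis .
  qed
  have "symcoeff (\<Sum>i=1..n. scale ((-1) ^ (i - 1)) (power_sum i * elementary (n - i)) :: 'a symfun) M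
      = (if size M = n then \<Sum>j\<in>set_mset M. of_bool (sqfree M) else 0)"
    by (subst symcoeff_sum_power_sum_mult, erule elementary_degree)
      (intro if_cong sum.cong refl *)
  also have "\<dots> = symcoeff (of_nat n * elementary n :: 'a symfun) M"
  proof -
    have "card (set_mset M) = size M" if "sqfree M"
    proof -
      have "count M j = 1" if "j \<in># M" for j
        using \<open>sqfree M\<close> count_greater_zero_iff [of M j] that
        by (simp add: sqfree_def le_antisym del: count_greater_zero_iff)
      then show ?thesis by (simp add: size_multiset_overloaded_eq)
    qed
    then show ?thesis
      by (auto simp: of_nat_mult_symfun symcoeff_elementary sqfree_def)
  qed
  finally show "symcoeff (of_nat n * elementary n :: 'a symfun) M =
    symcoeff (\<Sum>i=1..n. scale ((-1) ^ (i - 1)) (power_sum i * elementary (n - i))) M" ..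
qed

section \<open>Independence of the power sum products\<close>

lemma power_sum_prod_empty [simp]: "power_sum_prod {#} = 1"
  by (simp add: power_sum_prod_def)

lemma power_sum_prod_add_mset [simp]:
  "power_sum_prod (add_mset i \<mu>) = power_sum i * power_sum_prod \<mu>"
  by (simp add: power_sum_prod_def)

lemma power_sum_prod_union: "power_sum_prod (\<mu> + \<nu>) = power_sum_prod \<mu> * power_sum_prod \<nu>"
  by (simp add: power_sum_prod_def)

text \<open>
  The partition formed by the nonzero exponents of a monomial; the monomial \<open>M\<close> is a term of
  the monomial symmetric function indexed by \<open>exponents M\<close>.
\<close>

definition exponents :: "nat multiset \<Rightarrow> nat multiset" where
  "exponents M = image_mset (count M) (mset_set (set_mset M))"

lemma exponents_add_new_variable:
  assumes "i > 0" "j \<notin># M"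
  shows "exponents (M + replicate_mset i j) = add_mset i (exponents M)"
proof -
  have "set_mset (M + replicate_mset i j) = insert j (set_mset M)"
    using assms by auto
  moreover have "image_mset (count (M + replicate_mset i j)) (mset_set (set_mset M)) =
      image_mset (count M) (mset_set (set_mset M))"
    using assms by (intro image_mset_cong) auto
  moreover have "count M j = 0" using assms by (simp add: not_in_iff)
  ultimately show ?thesis
    using assms by (simp add: exponents_def)
qed

lemma exponents_remove_variable:
  assumes "j \<in># M"
  shows "exponents M = add_mset (count M j) (exponents (M - replicate_mset (count M j) j))"
proof -
  have "M - replicate_mset (count M j) j + replicate_mset (count M j) j = M"
    by (simp add: count_le_replicate_mset_subset_eq [symmetric] subset_mset.diff_add)
  moreover have "j \<notin># M - replicate_mset (count M j) j"
    by (simp add: not_in_iff)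
  ultimately show ?thesis
    using exponents_add_new_variable [of "count M j" j "M - replicate_mset (count M j) j"] assms
    by simp
qed

lemma ex_exponents:
  assumes "0 \<notin># \<mu>"
  shows "\<exists>M. exponents M = \<mu>"
  using assms
proof (induction \<mu>)
  case empty
  have "exponents {#} = {#}" by (simp add: exponents_def)
  then show ?case ..
next
  case (add i \<mu>)
  then obtain M where "exponents M = \<mu>" by auto
  moreover obtain j where "j \<notin># M" using ex_new_if_finite [of "set_mset M"] by auto
  ultimately have "exponents (M + replicate_mset i j) = add_mset i \<mu>"
    using add.prems by (simp add: exponents_add_new_variable)
  then show ?case ..
qed

lemma size_exponents: "size (exponents M) = card (set_mset M)"
  by (simp add: exponents_def)

text \<open>
  A monomial of \<open>p\<^sub>\<nu>\<close> assigns each part of \<open>\<nu>\<close> to a variable, so it involves at most as many variables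
  as \<open>\<nu>\<close> has parts, and with equally many variables no two parts are merged.
\<close>

lemma symcoeff_power_sum_prod_nonzero:
  assumes "0 \<notin># \<nu>" "symcoeff (power_sum_prod \<nu> :: 'a::comm_ring_1 symfun) M \<noteq> 0"
  shows "card (set_mset M) \<le> size \<nu> \<and> (card (set_mset M) = size \<nu> \<longrightarrow> exponents M = \<nu>)"
  using assms
proof (induction \<nu> arbitrary: M)
  case empty
  then show ?case by (auto simp: symcoeff_1 exponents_def split: if_splits)
next
  case (add i \<nu>)
  then have "i > 0" by auto
  with add.prems obtain j where j: "i \<le> count M j"
    and nz: "symcoeff (power_sum_prod \<nu> :: 'a symfun) (M - replicate_mset i j) \<noteq> 0"
    by (auto simp: symcoeff_power_sum_mult elim: sum.not_neutral_contains_not_neutral)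
  define M' where "M' = M - replicate_mset i j"
  have IH: "card (set_mset M') \<le> size \<nu>" "card (set_mset M') = size \<nu> \<Longrightarrow> exponents M' = \<nu>"
    using add.IH [OF _ nz] add.prems by (auto simp: M'_def)
  have "j \<in># M" using j \<open>i > 0\<close> by (metis count_greater_zero_iff less_le_trans)
  show ?case
  proof (cases "count M j = i")
    case True
    with \<open>j \<in># M\<close> have eq: "exponents M = add_mset i (exponents M')"
      unfolding M'_def using exponents_remove_variable by blast
    then have "card (set_mset M) = Suc (card (set_mset M'))"
      by (metis size_exponents size_add_mset)
    with IH eq show ?thesis by auto
  next
    case False
    have "set_mset M' = set_mset M"
    proof (rule set_eqI)
      fix x
      show "x \<in># M' \<longleftrightarrow> x \<in># M"
        using False j by (cases "x = j") (auto simp: M'_def in_diff_count \<open>j \<in># M\<close> count_greater_zero_iff [symmetric] simp del: count_greater_zero_iff)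
    qed
    with IH show ?thesis by auto
  qed
qed

text \<open>
  The coefficients count assignments of parts to variables. As natural numbers they cannot cancel,
  which makes the diagonal entry of the triangular system nonzero in characteristic \<open>0\<close>.
\<close>

lemma symcoeff_power_sum_prod_of_nat:
  "0 \<notin># \<nu> \<Longrightarrow> \<exists>N. symcoeff (power_sum_prod \<nu> :: 'a::comm_ring_1 symfun) M = of_nat N \<and>
    (exponents M = \<nu> \<longrightarrow> N > 0)"
proof (induction \<nu> arbitrary: M)
  case empty
  show ?case
    by (rule exI [of _ "if M = {#} then 1 else 0"]) (auto simp: symcoeff_1 exponents_def mset_set_empty_iff)
next
  case (add i \<nu>)
  then have i: "i > 0" and "0 \<notin># \<nu>" by auto
  from add.IH [OF \<open>0 \<notin># \<nu>\<close>] obtain N where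
    N: "symcoeff (power_sum_prod \<nu> :: 'a symfun) A = of_nat (N A)" "exponents A = \<nu> \<Longrightarrow> N A > 0" for A
    by metis
  show ?case
  proof (intro exI conjI impI)
    show "symcoeff (power_sum_prod (add_mset i \<nu>) :: 'a symfun) M =
        of_nat (\<Sum>j | i \<le> count M j. N (M - replicate_mset i j))"
      using i by (simp add: symcoeff_power_sum_mult N)
    assume ex: "exponents M = add_mset i \<nu>"
    then have "i \<in># exponents M" by simp
    then obtain j where j: "j \<in># M" "i = count M j" by (auto simp: exponents_def)
    with ex have "exponents (M - replicate_mset i j) = \<nu>"
      using exponents_remove_variable [of j M] by simp
    then have "N (M - replicate_mset i j) > 0" by (rule N)
    with j show "(\<Sum>j | i \<le> count M j. N (M - replicate_mset i j)) > 0"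
      using finite_count_ge [OF i] by (intro sum_pos2 [of _ j]) auto
  qed
qed

text \<open>
  Among the \<open>p\<^sub>\<mu>\<close> with nonzero coefficient take one with the most parts. A monomial with exponents \<open>\<mu>\<close>
  then occurs in no other of these products.
\<close>

lemma power_sum_prods_independent:
  fixes c :: "nat multiset \<Rightarrow> 'a::{idom, ring_char_0}"
  assumes fin: "finite S" and pos: "\<And>\<mu>. \<mu> \<in> S \<Longrightarrow> 0 \<notin># \<mu>"
    and zero: "(\<Sum>\<mu>\<in>S. scale (c \<mu>) (power_sum_prod \<mu>)) = 0"
    and "\<mu> \<in> S"
  shows "c \<mu> = 0"
proof (rule ccontr)
  assume "c \<mu> \<noteq> 0"
  define T where "T = {\<nu> \<in> S. c \<nu> \<noteq> 0}"
  have T: "finite T" "T \<noteq> {}" using fin \<open>\<mu> \<in> S\<close> \<open>c \<mu> \<noteq> 0\<close> by (auto simp: T_def)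
  define \<kappa> where "\<kappa> = arg_min_on (\<lambda>\<nu>. - int (size \<nu>)) T"
  have \<kappa>: "\<kappa> \<in> T" "\<And>\<nu>. \<nu> \<in> T \<Longrightarrow> size \<nu> \<le> size \<kappa>"
    using arg_min_if_finite [OF T, of "\<lambda>\<nu>. - int (size \<nu>)"] unfolding \<kappa>_def by force+
  then obtain M where M: "exponents M = \<kappa>" using ex_exponents pos by (auto simp: T_def)
  then have card: "card (set_mset M) = size \<kappa>" by (metis size_exponents)
  have "0 = (\<Sum>\<nu>\<in>S. c \<nu> * symcoeff (power_sum_prod \<nu>) M)"
    using arg_cong [OF zero, of "\<lambda>f. symcoeff f M"] by (simp add: symcoeff_sum)
  also have "\<dots> = (\<Sum>\<nu>\<in>{\<kappa>}. c \<nu> * symcoeff (power_sum_prod \<nu>) M)"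
  proof (rule sum.mono_neutral_right)
    show "\<forall>\<nu>\<in>S - {\<kappa>}. c \<nu> * symcoeff (power_sum_prod \<nu>) M = 0"
    proof (rule ballI, rule ccontr)
      fix \<nu> assume \<nu>: "\<nu> \<in> S - {\<kappa>}" "c \<nu> * symcoeff (power_sum_prod \<nu>) M \<noteq> 0"
      then have "card (set_mset M) \<le> size \<nu> \<and> (card (set_mset M) = size \<nu> \<longrightarrow> exponents M = \<nu>)"
        using pos by (intro symcoeff_power_sum_prod_nonzero [where 'a = 'a]) auto
      moreover have "size \<nu> \<le> size \<kappa>" using \<nu> \<kappa>(2) by (auto simp: T_def)
      ultimately have "\<nu> = \<kappa>" using M card by auto
      with \<nu> show False by simp
    qed
  qed (use fin \<kappa> in \<open>auto simp: T_def\<close>)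
  finally show False
    using symcoeff_power_sum_prod_of_nat [of \<kappa> M, where 'a = 'a] \<kappa>(1) pos M by (auto simp: T_def)
qed

section \<open>Coordinates and the scalar product\<close>

text \<open>
  The condition that singles out the coordinates in the definition of \<^const>\<open>power_sum_coords\<close>;
  independence makes \<open>c\<close> unique, so that the definite description there denotes it.
\<close>

definition power_sum_expansion :: "rat poly symfun \<Rightarrow> (nat multiset \<Rightarrow> rat poly) \<Rightarrow> bool" where
  "power_sum_expansion f c \<longleftrightarrow> finite {\<mu>. c \<mu> \<noteq> 0} \<and> (\<forall>\<mu>. c \<mu> \<noteq> 0 \<longrightarrow> 0 \<notin># \<mu>) \<and>
     f = (\<Sum>\<mu> | c \<mu> \<noteq> 0. scale (c \<mu>) (power_sum_prod \<mu>))"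

text \<open>
  An index set larger than the support is convenient when several expansions are combined.
\<close>

lemma power_sum_expansionI:
  assumes "finite S" "\<And>\<mu>. c \<mu> \<noteq> 0 \<Longrightarrow> \<mu> \<in> S \<and> 0 \<notin># \<mu>"
    and "f = (\<Sum>\<mu>\<in>S. scale (c \<mu>) (power_sum_prod \<mu>))"
  shows "power_sum_expansion f c"
  unfolding power_sum_expansion_def
proof (intro conjI allI impI)
  show "finite {\<mu>. c \<mu> \<noteq> 0}" using assms(1) by (rule finite_subset [rotated]) (use assms(2) in auto)
  show "f = (\<Sum>\<mu> | c \<mu> \<noteq> 0. scale (c \<mu>) (power_sum_prod \<mu>))"
    unfolding assms(3) using assms(1,2) by (intro sum.mono_neutral_right) auto
qed (use assms(2) in auto)

lemma power_sum_expansion_superset: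
  assumes "power_sum_expansion f c" "finite S" "{\<mu>. c \<mu> \<noteq> 0} \<subseteq> S"
  shows "f = (\<Sum>\<mu>\<in>S. scale (c \<mu>) (power_sum_prod \<mu>))"
proof -
  have "f = (\<Sum>\<mu> | c \<mu> \<noteq> 0. scale (c \<mu>) (power_sum_prod \<mu>))"
    using assms(1) by (simp add: power_sum_expansion_def)
  also have "\<dots> = (\<Sum>\<mu>\<in>S. scale (c \<mu>) (power_sum_prod \<mu>))"
    using assms(2,3) by (intro sum.mono_neutral_left) auto
  finally show ?thesis .
qed

lemma power_sum_expansion_0: "power_sum_expansion 0 (\<lambda>_. 0)"
  by (simp add: power_sum_expansion_def)

lemma power_sum_expansion_power_sum_prod:
  "0 \<notin># \<mu> \<Longrightarrow> power_sum_expansion (power_sum_prod \<mu>) (\<lambda>\<nu>. if \<nu> = \<mu> then 1 else 0)"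
  by (rule power_sum_expansionI [of "{\<mu>}"]) (auto split: if_splits)

lemma power_sum_expansion_scale_add:
  assumes f: "power_sum_expansion f c" and g: "power_sum_expansion g d"
  shows "power_sum_expansion (scale a f + g) (\<lambda>\<mu>. a * c \<mu> + d \<mu>)"
proof (rule power_sum_expansionI)
  let ?S = "{\<mu>. c \<mu> \<noteq> 0} \<union> {\<mu>. d \<mu> \<noteq> 0}"
  show S: "finite ?S" using f g by (simp add: power_sum_expansion_def)
  show "\<mu> \<in> ?S \<and> 0 \<notin># \<mu>" if "a * c \<mu> + d \<mu> \<noteq> 0" for \<mu>
    using f g that by (cases "c \<mu> = 0") (auto simp: power_sum_expansion_def)
  have "f = (\<Sum>\<mu>\<in>?S. scale (c \<mu>) (power_sum_prod \<mu>))"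
    "g = (\<Sum>\<mu>\<in>?S. scale (d \<mu>) (power_sum_prod \<mu>))"
    by (rule power_sum_expansion_superset [OF f S] power_sum_expansion_superset [OF g S]; auto)+
  then show "scale a f + g = (\<Sum>\<mu>\<in>?S. scale (a * c \<mu> + d \<mu>) (power_sum_prod \<mu>))"
    by (simp add: scale_add_left scale_sum_right sum.distrib flip: scale_scale)
qed

lemma power_sum_expansion_unique:
  assumes f: "power_sum_expansion f c" "power_sum_expansion f d"
  shows "c = d"
proof
  fix \<mu>
  let ?e = "\<lambda>\<mu>. -1 * c \<mu> + d \<mu>"
  have "scale (-1) f + f = 0" by (simp add: scale_minus_left)
  then have "power_sum_expansion 0 ?e"
    using power_sum_expansion_scale_add [OF f, of "-1"] by simp
  then have "?e \<mu> = 0"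
    using power_sum_prods_independent [of "{\<mu>. ?e \<mu> \<noteq> 0}" ?e \<mu>]
    unfolding power_sum_expansion_def by force
  then show "c \<mu> = d \<mu>" by simp
qed

lemma power_sum_coords_eq:
  assumes "power_sum_expansion f c"
  shows "power_sum_coords f = c"
  unfolding power_sum_coords_def power_sum_expansion_def [symmetric]
  using assms power_sum_expansion_unique by blast

lemma hall_scale_add:
  assumes f: "power_sum_expansion f c" and g: "power_sum_expansion g d"
  shows "hall (scale a f + g) h = a * hall f h + hall g h"
proof -
  let ?S = "{\<mu>. c \<mu> \<noteq> 0} \<union> {\<mu>. d \<mu> \<noteq> 0}"
  have S: "finite ?S" using f g by (simp add: power_sum_expansion_def)
  have "hall f' h = (\<Sum>\<mu>\<in>?S. c' \<mu> * power_sum_coords h \<mu> * of_nat (z_mset \<mu>))"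
    if "power_sum_expansion f' c'" "{\<mu>. c' \<mu> \<noteq> 0} \<subseteq> ?S" for f' c'
    unfolding hall_def power_sum_coords_eq [OF that(1)]
    using S that(2) by (intro sum.mono_neutral_left) auto
  note hall = this [OF f] this [OF g] this [OF power_sum_expansion_scale_add [OF f g]]
  show ?thesis
    by (subst hall(1), force, subst hall(2), force, subst hall(3), force)
      (simp add: sum.distrib sum_distrib_left algebra_simps)
qed

lemma hall_0_left: "hall 0 h = 0"
  by (simp add: hall_def power_sum_coords_eq [OF power_sum_expansion_0])

lemma hall_power_sum_prod:
  assumes "0 \<notin># \<mu>"
  shows "hall (power_sum_prod \<mu>) h = power_sum_coords h \<mu> * of_nat (z_mset \<mu>)"
  by (simp add: hall_def power_sum_coords_eq [OF power_sum_expansion_power_sum_prod [OF assms]])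

section \<open>The kernel: power sum coordinates of \<open>e\<^bsub>n-k\<^esub> h\<^sub>k\<close>\<close>

definition partitions_of :: "nat \<Rightarrow> nat multiset set" where
  "partitions_of n = {\<mu>. 0 \<notin># \<mu> \<and> sum_mset \<mu> = n}"

lemma size_le_sum_mset: "0 \<notin># \<mu> \<Longrightarrow> size \<mu> \<le> sum_mset (\<mu> :: nat multiset)"
  by (induction \<mu>) auto

lemma finite_partitions_of: "finite (partitions_of n)"
proof (rule finite_subset)
  show "finite (mset ` {xs. set xs \<subseteq> {..n} \<and> length xs \<le> n})"
    by (intro finite_imageI finite_lists_length_le) simp
  show "partitions_of n \<subseteq> mset ` {xs. set xs \<subseteq> {..n} \<and> length xs \<le> n}"
  proof
    fix \<mu> assume \<mu>: "\<mu> \<in> partitions_of n"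
    obtain xs where xs: "\<mu> = mset xs" by (metis ex_mset)
    have "set xs \<subseteq> {..n}"
      using \<mu> member_le_sum_list [of _ xs] xs by (auto simp: partitions_of_def sum_mset_sum_list)
    moreover have "length xs \<le> n"
      using \<mu> size_le_sum_mset [of \<mu>] xs by (auto simp: partitions_of_def)
    ultimately show "\<mu> \<in> mset ` {xs. set xs \<subseteq> {..n} \<and> length xs \<le> n}" using xs by auto
  qed
qed

lemma partitions_of_0 [simp]: "partitions_of 0 = {{#}}"
  by (auto simp: partitions_of_def sum_mset_0_iff) (metis multiset_nonemptyE)

lemma z_mset_empty [simp]: "z_mset {#} = 1"
  by (simp add: z_mset_def)

text \<open>
  This is the reason why \<open>z\<^sub>\<mu>\<close> normalises the scalar product: multiplication by \<open>p\<^sub>i\<close> becomes adjoint to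
  the derivation \<open>i \<partial>/\<partial>p\<^sub>i\<close>.
\<close>

lemma z_mset_add_mset: "z_mset (add_mset i \<mu>) = i * Suc (count \<mu> i) * z_mset \<mu>"
proof -
  let ?t = "\<lambda>\<mu> j. j ^ count \<mu> j * fact (count \<mu> j) :: nat"
  have *: "z_mset \<nu> = ?t \<nu> i * (\<Prod>j\<in>set_mset \<nu> - {i}. ?t \<nu> j)" for \<nu>
    unfolding z_mset_def
    by (cases "i \<in># \<nu>") (auto simp: prod.remove [of _ i] not_in_iff)
  have "(\<Prod>j\<in>set_mset (add_mset i \<mu>) - {i}. ?t (add_mset i \<mu>) j) = (\<Prod>j\<in>set_mset \<mu> - {i}. ?t \<mu> j)"
    by (rule prod.cong) auto
  then show ?thesis
    by (simp add: * [of \<mu>] * [of "add_mset i \<mu>"] algebra_simps)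
qed

lemma z_mset_pos: "0 \<notin># \<mu> \<Longrightarrow> z_mset \<mu> > 0"
  by (induction \<mu>) (auto simp: z_mset_add_mset)

text \<open>
  The image of \<open>p\<^sub>\<mu>\<close> under the ring homomorphism \<open>p\<^sub>i \<mapsto> t\<^sup>i - (-1)\<^sup>i\<close>, with \<open>t\<close> the outer indeterminate.
  It is the homomorphism whose coefficient of \<open>t\<^sup>k\<close> is the pairing with \<open>e\<^bsub>n-k\<^esub> h\<^sub>k\<close> in degree \<open>n\<close>, because
  \<open>\<Sum>\<^sub>a e\<^sub>a \<cdot> \<Sum>\<^sub>b h\<^sub>b t\<^sup>b = exp (\<Sum>\<^sub>i (t\<^sup>i - (-1)\<^sup>i) p\<^sub>i / i)\<close>.
\<close>

definition power_sum_value :: "nat multiset \<Rightarrow> rat poly poly" where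
  "power_sum_value \<mu> = (\<Prod>i\<in>#\<mu>. monom 1 i - (- 1) ^ i)"

lemma power_sum_value_empty [simp]: "power_sum_value {#} = 1"
  by (simp add: power_sum_value_def)

lemma power_sum_value_add_mset [simp]:
  "power_sum_value (add_mset i \<mu>) = (monom 1 i - (- 1) ^ i) * power_sum_value \<mu>"
  by (simp add: power_sum_value_def)

lemma power_sum_value_union:
  "power_sum_value (\<mu> + \<nu>) = power_sum_value \<mu> * power_sum_value \<nu>"
  by (simp add: power_sum_value_def)

lemma coeff_minus_one_power_mult: "coeff ((-1) ^ i * p) k = (-1) ^ i * coeff (p :: 'a::comm_ring_1 poly) k"
  by (cases "even i") simp_all

text \<open>
  The coefficient of \<open>p\<^sub>\<mu> t\<^sup>k\<close> in that exponential.
\<close>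

definition kernel_coord :: "nat \<Rightarrow> nat multiset \<Rightarrow> rat poly" where
  "kernel_coord k \<mu> = smult (1 / of_nat (z_mset \<mu>)) (coeff (power_sum_value \<mu>) k)"

text \<open>
  Choosing a part \<open>i\<close> and then a partition of \<open>n - i\<close> amounts to choosing a partition of \<open>n\<close> and one of
  its distinct parts to remove.
\<close>

lemma sum_partitions_remove_part:
  fixes F :: "nat \<Rightarrow> nat multiset \<Rightarrow> 'b::comm_monoid_add"
  shows "(\<Sum>i=1..n. \<Sum>\<nu>\<in>partitions_of (n - i). F i \<nu>) =
    (\<Sum>\<mu>\<in>partitions_of n. \<Sum>i\<in>set_mset \<mu>. F i (\<mu> - {#i#}))"
proof -
  have "(\<Sum>i=1..n. \<Sum>\<nu>\<in>partitions_of (n - i). F i \<nu>) =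
      (\<Sum>(i, \<nu>)\<in>Sigma {1..n} (\<lambda>i. partitions_of (n - i)). F i \<nu>)"
    by (rule sum.Sigma) (auto simp: finite_partitions_of)
  also have "\<dots> = (\<Sum>(\<mu>, i)\<in>Sigma (partitions_of n) set_mset. F i (\<mu> - {#i#}))"
  proof (rule sum.reindex_bij_witness [where i = "\<lambda>(\<mu>, i). (i, \<mu> - {#i#})"
        and j = "\<lambda>(i, \<nu>). (add_mset i \<nu>, i)"])
    fix P assume "P \<in> Sigma (partitions_of n) set_mset"
    then obtain \<mu> i where P: "P = (\<mu>, i)" "\<mu> \<in> partitions_of n" "i \<in># \<mu>" by auto
    from P(3) obtain \<nu> where "\<mu> = add_mset i \<nu>" by (metis insert_DiffM)
    with P show "(case P of (\<mu>, i) \<Rightarrow> (i, \<mu> - {#i#})) \<in> Sigma {1..n} (\<lambda>i. partitions_of (n - i))"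
      by (auto simp: partitions_of_def)
  qed (auto simp: partitions_of_def)
  also have "\<dots> = (\<Sum>\<mu>\<in>partitions_of n. \<Sum>i\<in>set_mset \<mu>. F i (\<mu> - {#i#}))"
    by (rule sum.Sigma [symmetric]) (auto simp: finite_partitions_of)
  finally show ?thesis .
qed

text \<open>
  Extending the family by \<open>0\<close> to \<open>k > n\<close> removes the side condition \<open>k \<le> n\<close> from the recursion below.
\<close>

definition elem_hom :: "nat \<Rightarrow> nat \<Rightarrow> 'a::comm_ring_1 symfun" where
  "elem_hom n k = (if k \<le> n then elementary (n - k) * homogeneous k else 0)"

text \<open>
  The identity for \<open>h\<^sub>k\<close> multiplied by \<open>e\<^bsub>n-k\<^esub>\<close>, plus the identity for \<open>e\<^bsub>n-k\<^esub>\<close> multiplied by \<open>h\<^sub>k\<close>. The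
  factor of \<open>p\<^sub>i\<close> is the action of \<open>t\<^sup>i - (-1)\<^sup>i\<close> on the generating function in \<open>k\<close>.
\<close>

lemma newton_elem_hom:
  "scale (of_nat n) (elem_hom n k) = (\<Sum>i=1..n. power_sum i *
     ((if i \<le> k then elem_hom (n - i) (k - i) else 0) - scale ((-1) ^ i) (elem_hom (n - i) k)))"
    (is "_ = (\<Sum>i=1..n. ?t i)")
proof (cases "k \<le> n")
  case False
  then have "power_sum i * ((if i \<le> k then elem_hom (n - i) (k - i) else 0) -
      scale ((-1) ^ i) (elem_hom (n - i) k)) = (0 :: 'a symfun)" if "i \<in> {1..n}" for i
    using that by (auto simp: elem_hom_def)
  then show ?thesis using False by (simp add: elem_hom_def)
next
  case True
  have "(\<Sum>i=1..k. power_sum i * (elementary (n - k) * homogeneous (k - i))) =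
      (\<Sum>i=1..n. power_sum i * (if i \<le> k then elem_hom (n - i) (k - i) else 0))"
    using True by (intro sum.mono_neutral_cong_left) (auto simp: elem_hom_def)
  then have h: "elementary (n - k) * (of_nat k * homogeneous k) = \<dots>"
    by (simp add: newton_homogeneous sum_distrib_left mult.left_commute)
  have "(\<Sum>i=1..n-k. scale ((-1) ^ (i - 1)) (power_sum i * (elementary (n - k - i) * homogeneous k))) =
      (\<Sum>i=1..n. power_sum i * - scale ((-1) ^ i) (elem_hom (n - i) k))"
  proof (intro sum.mono_neutral_cong_left ballI)
    fix i assume "i \<in> {1..n-k}"
    then obtain i' where "i = Suc i'" "k \<le> n - i" by (cases i) auto
    then show "scale ((-1) ^ (i - 1)) (power_sum i * (elementary (n - k - i) * homogeneous k)) =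
        power_sum i * - scale ((-1) ^ i) (elem_hom (n - i) k)"
      by (simp add: elem_hom_def scale_minus_left add.commute)
  qed (auto simp: elem_hom_def)
  then have e: "(of_nat (n - k) * elementary (n - k)) * homogeneous k = \<dots>"
    by (simp add: newton_elementary sum_distrib_right mult.assoc)
  have "scale (of_nat n) (elem_hom n k) = (of_nat (n - k) + of_nat k) * (elementary (n - k) * homogeneous k)"
    using True by (simp add: elem_hom_def of_nat_mult_symfun flip: of_nat_add)
  also have "\<dots> = elementary (n - k) * (of_nat k * homogeneous k) +
      (of_nat (n - k) * elementary (n - k)) * homogeneous k"
    by (simp add: algebra_simps)
  also have "\<dots> = (\<Sum>i=1..n. ?t i)"
    unfolding h e by (simp add: algebra_simps flip: sum.distrib)
  finally show ?thesis .
qed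

lemma kernel_coord_add_mset:
  assumes "0 \<notin># \<nu>" "i > 0"
  shows "(if i \<le> k then kernel_coord (k - i) \<nu> else 0) - (-1) ^ i * kernel_coord k \<nu> =
    of_nat (i * count (add_mset i \<nu>) i) * kernel_coord k (add_mset i \<nu>)"
proof -
  let ?c = "coeff (power_sum_value (add_mset i \<nu>)) k"
  have z: "z_mset (add_mset i \<nu>) = i * Suc (count \<nu> i) * z_mset \<nu>"
    by (rule z_mset_add_mset)
  have ne: "rat_of_nat (i * Suc (count \<nu> i)) \<noteq> 0"
    using assms by (simp only: of_nat_eq_0_iff) simp
  have "?c = (if i \<le> k then coeff (power_sum_value \<nu>) (k - i) else 0) -
      (-1) ^ i * coeff (power_sum_value \<nu>) k"
    by (simp add: left_diff_distrib coeff_monom_mult coeff_minus_one_power_mult)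
  then have "(if i \<le> k then kernel_coord (k - i) \<nu> else 0) - (-1) ^ i * kernel_coord k \<nu> =
      smult (1 / of_nat (z_mset \<nu>)) ?c"
    by (simp add: kernel_coord_def smult_diff_right)
  also have "\<dots> = smult (of_nat (i * Suc (count \<nu> i)) * (1 / of_nat (z_mset (add_mset i \<nu>)))) ?c"
    unfolding z of_nat_mult [of "i * Suc (count \<nu> i)"] using ne
    by (simp del: of_nat_mult of_nat_Suc)
  also have "\<dots> = of_nat (i * count (add_mset i \<nu>) i) * kernel_coord k (add_mset i \<nu>)"
    unfolding kernel_coord_def by (simp add: of_nat_poly)
  finally show ?thesis .
qed

lemma sum_mset_eq_sum_count: "sum_mset \<mu> = (\<Sum>i\<in>set_mset \<mu>. i * count \<mu> i)" for \<mu> :: "nat multiset"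
proof -
  have "finite S \<Longrightarrow> set_mset \<mu> \<subseteq> S \<Longrightarrow> sum_mset \<mu> = (\<Sum>i\<in>S. i * count \<mu> i)" for S
  proof (induction \<mu>)
    case (add x \<mu>)
    have "(\<Sum>i\<in>S. i * count (add_mset x \<mu>) i) = (\<Sum>i\<in>S. i * count \<mu> i + (if i = x then i else 0))"
      by (rule sum.cong) auto
    with add show ?case by (simp add: sum.distrib)
  qed simp
  then show ?thesis by simp
qed

text \<open>
  Both sides satisfy the same recursion in \<open>n\<close>. On the right it closes up because the distinct parts of
  \<open>\<mu>\<close>, each weighted by its value times its multiplicity, add up to \<open>n\<close>.
\<close>

lemma elem_hom_eq_kernel:
  "elem_hom n k = (\<Sum>\<mu>\<in>partitions_of n. scale (kernel_coord k \<mu>) (power_sum_prod \<mu>))"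
proof (induction n arbitrary: k rule: less_induct)
  case (less n)
  let ?K = "\<lambda>n k. \<Sum>\<mu>\<in>partitions_of n. scale (kernel_coord k \<mu>) (power_sum_prod \<mu>)"
  show ?case
  proof (cases "n = 0")
    case True
    then show ?thesis by (simp add: elem_hom_def kernel_coord_def)
  next
    case False
    let ?t = "\<lambda>i \<nu>. scale (of_nat (i * count (add_mset i \<nu>) i) * kernel_coord k (add_mset i \<nu>))
      (power_sum_prod (add_mset i \<nu>))"
    have "scale (of_nat n) (elem_hom n k) = (\<Sum>i=1..n. power_sum i *
        ((if i \<le> k then ?K (n - i) (k - i) else 0) - scale ((-1) ^ i) (?K (n - i) k)))"
      unfolding newton_elem_hom by (intro sum.cong refl) (simp add: less.IH)
    also have "\<dots> = (\<Sum>i=1..n. \<Sum>\<nu>\<in>partitions_of (n - i). ?t i \<nu>)"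
    proof (rule sum.cong)
      fix i assume i: "i \<in> {1..n}"
      have "power_sum i * ((if i \<le> k then ?K (n - i) (k - i) else 0) - scale ((-1) ^ i) (?K (n - i) k)) =
          (\<Sum>\<nu>\<in>partitions_of (n - i). scale ((if i \<le> k then kernel_coord (k - i) \<nu> else 0) -
             (-1) ^ i * kernel_coord k \<nu>) (power_sum_prod (add_mset i \<nu>)))"
        by (cases "i \<le> k") (simp_all add: scale_sum_right sum_distrib_left right_diff_distrib
            scale_diff_left scale_minus_left sum_subtractf sum_negf)
      also have "\<dots> = (\<Sum>\<nu>\<in>partitions_of (n - i). ?t i \<nu>)"
        using i by (intro sum.cong refl, subst kernel_coord_add_mset) (auto simp: partitions_of_def)
      finally show "power_sum i * ((if i \<le> k then ?K (n - i) (k - i) else 0) -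
          scale ((-1) ^ i) (?K (n - i) k)) = \<dots>" .
    qed simp
    also have "\<dots> = (\<Sum>\<mu>\<in>partitions_of n. \<Sum>i\<in>set_mset \<mu>. ?t i (\<mu> - {#i#}))"
      by (rule sum_partitions_remove_part)
    also have "\<dots> = (\<Sum>\<mu>\<in>partitions_of n. scale (of_nat n * kernel_coord k \<mu>) (power_sum_prod \<mu>))"
    proof (rule sum.cong)
      fix \<mu> assume "\<mu> \<in> partitions_of n"
      then have "n = (\<Sum>i\<in>set_mset \<mu>. i * count \<mu> i)"
        by (simp add: partitions_of_def sum_mset_eq_sum_count)
      then show "(\<Sum>i\<in>set_mset \<mu>. ?t i (\<mu> - {#i#})) =
          scale (of_nat n * kernel_coord k \<mu>) (power_sum_prod \<mu>)"
        by (simp add: insert_DiffM sum_distrib_right scale_sum_left del: count_add_mset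
            power_sum_prod_add_mset)
    qed simp
    finally have eq: "scale (of_nat n) (elem_hom n k) = scale (of_nat n) (?K n k)"
      by (simp add: scale_sum_right)
    have "[:1 / of_nat n:] * of_nat n = (1 :: rat poly)"
      using False by (simp add: of_nat_poly one_pCons)
    with arg_cong [OF eq, of "scale [:1 / of_nat n:]"] show ?thesis by simp
  qed
qed

lemma power_sum_coords_elem_hom:
  assumes "\<mu> \<in> partitions_of n"
  shows "power_sum_coords (elem_hom n k) \<mu> = kernel_coord k \<mu>"
proof -
  let ?c = "\<lambda>\<mu>. if \<mu> \<in> partitions_of n then kernel_coord k \<mu> else 0"
  have "power_sum_expansion (elem_hom n k) ?c"
    by (rule power_sum_expansionI [OF finite_partitions_of [of n]])
      (auto simp: elem_hom_eq_kernel partitions_of_def split: if_splits)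
  then show ?thesis using assms by (simp add: power_sum_coords_eq)
qed

lemma hall_power_sum_prod_elem_hom:
  assumes "\<mu> \<in> partitions_of n"
  shows "hall (power_sum_prod \<mu>) (elem_hom n k) = coeff (power_sum_value \<mu>) k"
proof -
  have "0 \<notin># \<mu>" using assms by (simp add: partitions_of_def)
  with z_mset_pos [of \<mu>] show ?thesis
    using assms
    by (simp add: hall_power_sum_prod power_sum_coords_elem_hom kernel_coord_def of_nat_poly)
qed

section \<open>The scalar product as a specialization\<close>

text \<open>
  \<open>specializes n f v\<close> holds if \<open>f\<close> is homogeneous of degree \<open>n\<close> and \<open>v\<close> is its image under
  \<open>p\<^sub>i \<mapsto> t\<^sup>i - (-1)\<^sup>i\<close>. Generating the relation from the pairs of \<open>p\<^sub>\<mu>\<close> and its image lets linear and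
  multiplicative properties be proved by induction, without handling coordinates.
\<close>

inductive specializes :: "nat \<Rightarrow> rat poly symfun \<Rightarrow> rat poly poly \<Rightarrow> bool" for n where
  zero: "specializes n 0 0"
| step: "specializes n f v \<Longrightarrow> \<mu> \<in> partitions_of n \<Longrightarrow>
    specializes n (scale a (power_sum_prod \<mu>) + f) (smult a (power_sum_value \<mu>) + v)"

text \<open>
  Both sides are linear in \<open>f\<close> and agree on the \<open>p\<^sub>\<mu>\<close>.
\<close>

lemma hall_elem_hom:
  assumes "specializes n f v"
  shows "hall f (elem_hom n k) = coeff v k"
proof -
  from assms have "(\<exists>c. power_sum_expansion f c) \<and> hall f (elem_hom n k) = coeff v k"
  proof induction
    case zero
    show ?case using power_sum_expansion_0 by (auto simp: hall_0_left)
  next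
    case (step f v \<mu> a)
    then obtain c where c: "power_sum_expansion f c" by auto
    have "0 \<notin># \<mu>" using step.hyps by (simp add: partitions_of_def)
    note p = power_sum_expansion_power_sum_prod [OF this]
    show ?case
      using step hall_scale_add [OF p c] power_sum_expansion_scale_add [OF p c, of a]
      by (auto simp: hall_power_sum_prod_elem_hom)
  qed
  then show ?thesis ..
qed

lemma specializes_power_sum_prod:
  "\<mu> \<in> partitions_of n \<Longrightarrow> specializes n (power_sum_prod \<mu>) (power_sum_value \<mu>)"
  using specializes.step [OF specializes.zero, of \<mu> n 1] by simp

lemma specializes_add:
  assumes "specializes n f v" "specializes n g u"
  shows "specializes n (f + g) (v + u)"
  using assms
proof induction
  case (step f v \<mu> a)
  then have "specializes n (scale a (power_sum_prod \<mu>) + (f + g)) (smult a (power_sum_value \<mu>) + (v + u))"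
    by (intro specializes.step)
  then show ?case by (simp add: add.assoc)
qed simp

lemma specializes_scale:
  assumes "specializes n f v"
  shows "specializes n (scale b f) (smult b v)"
  using assms
proof induction
  case (step f v \<mu> a)
  then have "specializes n (scale (b * a) (power_sum_prod \<mu>) + scale b f) (smult (b * a) (power_sum_value \<mu>) + smult b v)"
    by (intro specializes.step)
  then show ?case by (simp add: scale_add_right smult_add_right)
qed (simp add: specializes.zero)

lemma specializes_sum:
  "(\<And>x. x \<in> X \<Longrightarrow> specializes n (f x) (v x)) \<Longrightarrow>
    specializes n (\<Sum>x\<in>X. f x) (\<Sum>x\<in>X. v x)"
  by (induction X rule: infinite_finite_induct) (auto intro: specializes.zero specializes_add)

lemma specializes_power_sum_prod_mult:
  assumes "\<mu> \<in> partitions_of m" "specializes n g u"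
  shows "specializes (m + n) (power_sum_prod \<mu> * g) (power_sum_value \<mu> * u)"
  using assms(2)
proof induction
  case (step g u \<nu> a)
  have "\<mu> + \<nu> \<in> partitions_of (m + n)"
    using assms(1) step.hyps by (simp add: partitions_of_def)
  from specializes.step [OF step.IH this, of a] show ?case
    by (simp add: algebra_simps power_sum_prod_union power_sum_value_union)
qed (simp add: specializes.zero)

lemma specializes_mult:
  assumes "specializes m f v" "specializes n g u"
  shows "specializes (m + n) (f * g) (v * u)"
  using assms(1)
proof induction
  case (step f v \<mu> a)
  then show ?case
    using specializes_add [OF specializes_scale [OF specializes_power_sum_prod_mult
          [OF step.hyps(2) assms(2)], of a] step.IH]
    by (simp add: algebra_simps)
qed (simp add: specializes.zero)

lemma alternating_geometric_sum: "(1 + monom 1 1) * (\<Sum>i<r. (-1) ^ i * monom 1 i) = 1 - (-1) ^ r * (monom 1 r :: rat poly poly)"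
proof (induction r)
  case (Suc r)
  have "(1 + monom 1 1) * (\<Sum>i<Suc r. (-1) ^ i * monom 1 i) =
      (1 - (-1) ^ r * monom 1 r) + (1 + monom 1 1) * ((-1) ^ r * (monom 1 r :: rat poly poly))"
    using Suc.IH by (simp only: sum.lessThan_Suc distrib_left)
  also have "\<dots> = 1 - (-1) ^ Suc r * (monom 1 1 * monom 1 r)"
    by (simp add: algebra_simps)
  also have "monom 1 1 * monom 1 r = (monom 1 (Suc r) :: rat poly poly)"
    by (simp add: mult_monom)
  finally show ?case .
qed (simp add: one_pCons monom_0)

text \<open>
  Every \<open>e\<^sub>r\<close> with \<open>r > 0\<close> has the same image \<open>1 + t\<close>: the homomorphism sends the generating function
  \<open>\<Sum>\<^sub>r e\<^sub>r u\<^sup>r\<close> to \<open>(1 + t u) / (1 - u)\<close>. The proof runs Newton's identity on the images.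
\<close>

lemma specializes_elementary:
  "specializes r (elementary r) (if r = 0 then 1 else 1 + monom 1 1)"
proof (induction r rule: less_induct)
  case (less r)
  show ?case
  proof (cases "r = 0")
    case True
    then show ?thesis using specializes_power_sum_prod [of "{#}" 0] by simp
  next
    case False
    define v :: "nat \<Rightarrow> rat poly poly" where "v = (\<lambda>r. if r = 0 then 1 else 1 + monom 1 1)"
    have "specializes r (scale ((-1) ^ (i - 1)) (power_sum i * elementary (r - i)))
        (smult ((-1) ^ (i - 1)) ((monom 1 i - (-1) ^ i) * v (r - i)))" if "i \<in> {1..r}" for i
    proof -
      have "{#i#} \<in> partitions_of i" using that by (simp add: partitions_of_def)
      from specializes_power_sum_prod_mult [OF this less.IH, of "r - i"] that
      show ?thesis by (intro specializes_scale) (simp add: v_def)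
    qed
    then have *: "specializes r (of_nat r * elementary r)
        (\<Sum>i=1..r. smult ((-1) ^ (i - 1)) ((monom 1 i - (-1) ^ i) * v (r - i)))"
      unfolding newton_elementary by (rule specializes_sum)
    have "(\<Sum>i=1..r. smult ((-1) ^ (i - 1)) ((monom 1 i - (-1) ^ i) * v (r - i))) =
        (\<Sum>i=1..r. (1 - (-1) ^ i * monom 1 i) * v (r - i))"
    proof (rule sum.cong)
      fix i assume "i \<in> {1..r}"
      then obtain j where "i = Suc j" by (cases i) auto
      then show "smult ((-1) ^ (i - 1)) ((monom 1 i - (-1) ^ i) * v (r - i)) =
          (1 - (-1) ^ i * monom 1 i) * v (r - i)"
        by (cases "even j") (simp_all add: algebra_simps)
    qed simp
    also have "\<dots> = of_nat r * (1 + monom 1 1)"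
    proof -
      obtain s where s: "r = Suc s" using False by (cases r) auto
      have "(\<Sum>i=1..r. (1 - (-1) ^ i * monom 1 i) * v (r - i)) =
          (\<Sum>i=1..s. (1 - (-1) ^ i * monom 1 i) * (1 + monom 1 1)) + (1 - (-1) ^ r * monom 1 r)"
        by (simp add: s v_def)
      also have "(\<Sum>i=1..s. (1 - (-1) ^ i * monom 1 i) * (1 + monom 1 1)) =
          (of_nat r - (\<Sum>i<r. (-1) ^ i * monom 1 i)) * (1 + monom 1 1 :: rat poly poly)"
      proof -
        have "(\<Sum>i<r. (-1) ^ i * monom 1 i) = (1 + (\<Sum>i=1..s. (-1) ^ i * monom 1 i) :: rat poly poly)"
          by (simp add: s lessThan_Suc_atMost atMost_atLeast0 sum.atLeast_Suc_atMost)
        then show ?thesis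
          by (simp add: s sum_subtractf flip: sum_distrib_right)
      qed
      also have "\<dots> + (1 - (-1) ^ r * monom 1 r) = of_nat r * (1 + monom 1 1)"
        unfolding alternating_geometric_sum [symmetric] by (simp add: algebra_simps)
      finally show ?thesis .
    qed
    finally have "specializes r (scale (of_nat r) (elementary r)) (smult (of_nat r) (1 + monom 1 1))"
      using * by (simp add: of_nat_mult_symfun of_nat_poly)
    note scaled = specializes_scale [OF this, of "[:1 / of_nat r:]"]
    have "[:1 / of_nat r:] * of_nat r = (1 :: rat poly)"
      using False by (simp add: of_nat_poly one_pCons)
    with scaled False show ?thesis by (simp only: scale_scale smult_smult scale_1 smult_1_left if_False)
  qed
qed

lemma specializes_elementary_prod:
  "(\<And>k. k \<in> set ks \<Longrightarrow> k > 0) \<Longrightarrow>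
    specializes (sum_list ks) (\<Prod>k\<leftarrow>ks. elementary k) ((1 + monom 1 1) ^ length ks)"
proof (induction ks)
  case Nil
  then show ?case using specializes_elementary [of 0] by simp
next
  case (Cons k ks)
  then have "k > 0" "specializes (sum_list ks) (\<Prod>k\<leftarrow>ks. elementary k) ((1 + monom 1 1) ^ length ks)"
    by simp_all
  then show ?case
    using specializes_mult [OF specializes_elementary [of k]] by simp
qed

section \<open>Lattice paths with arbitrary starting point\<close>

text \<open>
  Prefixes \<open>replicate c True\<close> stand for a riser of which \<open>c\<close> up steps have already been read.
\<close>

lemma run_lengths_replicate_Nil [simp]:
  "run_lengths (replicate c True) = (if c = 0 then [] else [c])"
  by (cases c) auto

lemma run_lengths_replicate_False [simp]:
  "run_lengths (replicate c True @ False # bs) = (if c = 0 then [] else [c]) @ run_lengths bs"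
proof -
  have "takeWhile (\<lambda>b. b) (replicate c True @ False # bs) = replicate c True"
    "dropWhile (\<lambda>b. b) (replicate c True @ False # bs) = False # bs" for c
    by (induction c) auto
  then show ?thesis by (cases c) auto
qed

lemma run_lengths_replicate_True [simp]:
  "run_lengths (replicate c True @ True # bs) = run_lengths (replicate (Suc c) True @ bs)"
proof -
  have "replicate c True @ True # bs = replicate (Suc c) True @ bs"
    by (simp add: replicate_app_Cons_same)
  then show ?thesis by (simp only:)
qed

lemma run_lengths_pos: "k \<in> set (run_lengths bs) \<Longrightarrow> k > 0"
  by (induction bs rule: run_lengths.induct) auto

lemma sum_list_run_lengths: "sum_list (run_lengths bs) = length (filter (\<lambda>b. b) bs)"
proof (induction bs rule: run_lengths.induct)
  case (3 bs)
  have "length (filter (\<lambda>b. b) bs) =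
      length (filter (\<lambda>b. b) (takeWhile (\<lambda>b. b) bs @ dropWhile (\<lambda>b. b) bs))"
    by simp
  also have "\<dots> = length (takeWhile (\<lambda>b. b) bs) + length (filter (\<lambda>b. b) (dropWhile (\<lambda>b. b) bs))"
  proof -
    have "filter (\<lambda>b. b) (takeWhile (\<lambda>b. b) bs) = takeWhile (\<lambda>b. b) bs"
      by (auto simp: filter_id_conv dest: set_takeWhileD)
    then show ?thesis unfolding filter_append by simp
  qed
  finally show ?case using 3 by simp
qed auto

definition lattice_step :: "nat \<times> nat \<Rightarrow> nat \<times> nat \<Rightarrow> bool" where
  "lattice_step P Q \<longleftrightarrow> Q = P + (0, 1) \<or> Q = P + (1, 1) \<or> Q = P + (1, 0)"

definition weakly_above :: "nat \<Rightarrow> nat \<Rightarrow> nat \<times> nat \<Rightarrow> bool" where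
  "weakly_above m n = (\<lambda>(u, v). int m * int v - int n * int u \<ge> 0)"

definition paths_from :: "nat \<Rightarrow> nat \<Rightarrow> nat \<times> nat \<Rightarrow> (nat \<times> nat) list set" where
  "paths_from m n P = {\<alpha>. \<alpha> \<noteq> [] \<and> hd \<alpha> = P \<and> last \<alpha> = (m, n) \<and>
     (\<forall>Q \<in> set \<alpha>. weakly_above m n Q) \<and> successively lattice_step \<alpha>}"

lemma schroeder_paths_eq: "schroeder_paths m n = paths_from m n (0, 0)"
  by (simp add: schroeder_paths_def paths_from_def weakly_above_def lattice_step_def [abs_def])

lemma segments_Cons_Cons [simp]: "segments (P # Q # \<alpha>) = (P, Q) # segments (Q # \<alpha>)"
  by (simp add: segments_def)

lemma segments_single [simp]: "segments [P] = []"
  by (simp add: segments_def)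

lemma path_monotone:
  "successively lattice_step \<alpha> \<Longrightarrow> \<alpha> \<noteq> [] \<Longrightarrow> fst (hd \<alpha>) \<le> fst (last \<alpha>) \<and> snd (hd \<alpha>) \<le> snd (last \<alpha>)"
  by (induction \<alpha> rule: induct_list012) (auto simp: lattice_step_def)

lemma paths_from_bounded:
  "\<alpha> \<in> paths_from m n (u, v) \<Longrightarrow> u \<le> m \<and> v \<le> n"
  using path_monotone [of \<alpha>] by (auto simp: paths_from_def)

lemma paths_from_not_above:
  "\<not> weakly_above m n P \<Longrightarrow> paths_from m n P = {}"
  by (auto simp: paths_from_def dest: hd_in_set)

lemma paths_from_decompose:
  "\<alpha> \<in> paths_from m n P \<longleftrightarrow> (\<alpha> = [(m, n)] \<and> P = (m, n) \<and> weakly_above m n P) \<or>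
     (\<exists>\<beta> Q. \<alpha> = P # \<beta> \<and> weakly_above m n P \<and> lattice_step P Q \<and> \<beta> \<in> paths_from m n Q)"
  by (cases \<alpha>) (auto simp: paths_from_def successively_Cons simp del: split_paired_Ex)

text \<open>
  A continuation would have to leave the rectangle.
\<close>

lemma paths_from_end: "paths_from m n (m, n) = {[(m, n)]}"
proof -
  have "paths_from m n Q = {}" if "lattice_step (m, n) Q" for Q
    using that paths_from_bounded [of _ m n "fst Q" "snd Q"] by (fastforce simp: lattice_step_def)
  moreover have "weakly_above m n (m, n)" by (simp add: weakly_above_def mult.commute)
  ultimately show ?thesis by (auto simp: paths_from_decompose [of _ m n "(m, n)"])
qed

lemma paths_from_step:
  assumes "(u, v) \<noteq> (m, n)" "weakly_above m n (u, v)"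
  shows "paths_from m n (u, v) = (#) (u, v) `
    (paths_from m n (u, Suc v) \<union> paths_from m n (Suc u, Suc v) \<union> paths_from m n (Suc u, v))"
  using assms by (auto simp: set_eq_iff image_iff lattice_step_def paths_from_decompose [of _ m n "(u, v)"])

lemma finite_paths_from: "finite (paths_from m n (u, v))"
proof (induction "(Suc m - u) + (Suc n - v)" arbitrary: u v rule: less_induct)
  case less
  show ?case
  proof (cases "u \<le> m \<and> v \<le> n \<and> weakly_above m n (u, v) \<and> (u, v) \<noteq> (m, n)")
    case True
    then have "finite (paths_from m n (u, Suc v))" "finite (paths_from m n (Suc u, Suc v))"
      "finite (paths_from m n (Suc u, v))"
      by (intro less; arith)+
    with True show ?thesis by (simp add: paths_from_step)
  next
    case False
    then have "paths_from m n (u, v) \<subseteq> {[(m, n)]}"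
      using paths_from_bounded [of _ m n u v] paths_from_not_above [of m n "(u, v)"]
        paths_from_end [of m n] by blast
    then show ?thesis by (rule finite_subset) simp
  qed
qed

lemma segments_height:
  "successively lattice_step \<alpha> \<Longrightarrow> (A, B) \<in> set (segments \<alpha>) \<Longrightarrow> snd (hd \<alpha>) \<le> snd A"
  by (induction \<alpha> rule: induct_list012) (auto simp: lattice_step_def segments_def)

text \<open>
  A first step that does not rise out of row \<open>i\<close> contributes nothing to the description of
  \<^const>\<open>row_start\<close>.
\<close>

lemma row_start_Cons:
  assumes "\<not> (snd P = i \<and> snd Q = Suc i)"
  shows "row_start (P # Q # \<beta>) i = row_start (Q # \<beta>) i"
proof -
  have "((u, i), (u', Suc i)) \<in> set (segments (P # Q # \<beta>)) \<longleftrightarrow>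
      ((u, i), (u', Suc i)) \<in> set (segments (Q # \<beta>))" for u u'
    using assms by auto
  then show ?thesis by (simp only: row_start_def)
qed

lemma row_start_first:
  assumes "successively lattice_step ((u', Suc v) # \<beta>)"
  shows "row_start ((u, v) # (u', Suc v) # \<beta>) v = u"
  unfolding row_start_def
proof (rule the_equality)
  fix a assume "\<exists>b. ((a, v), (b, Suc v)) \<in> set (segments ((u, v) # (u', Suc v) # \<beta>))"
  then show "a = u" using segments_height [OF assms] by fastforce
qed auto

definition row_area :: "nat \<Rightarrow> nat \<Rightarrow> nat \<Rightarrow> nat \<Rightarrow> int" where
  "row_area m n u i = \<lfloor>of_nat (i * m) / (of_nat n :: rat)\<rfloor> - int u"

text \<open>
  The part of the area that lies in the rows still ahead of the path; rows below its starting point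
  would have no well-defined start.
\<close>

definition area_above :: "nat \<Rightarrow> nat \<Rightarrow> (nat \<times> nat) list \<Rightarrow> int" where
  "area_above m n \<alpha> = (\<Sum>i=snd (hd \<alpha>)..<n. row_area m n (row_start \<alpha> i) i)"

lemma area_eq_area_above: "\<alpha> \<in> paths_from m n (0, 0) \<Longrightarrow> area m n \<alpha> = area_above m n \<alpha>"
  by (simp add: area_def area_above_def row_area_def paths_from_def atLeast0LessThan)

lemma row_area_nonneg:
  assumes "n > 0" "weakly_above m n (u, i)"
  shows "row_area m n u i \<ge> 0"
proof -
  have "u * n \<le> i * m"
    using assms(2) by (simp add: weakly_above_def algebra_simps flip: of_nat_mult)
  then have "(of_nat (u * n) :: rat) \<le> of_nat (i * m)" by (simp only: of_nat_le_iff)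
  then have "(of_int (int u) :: rat) \<le> of_nat (i * m) / of_nat n"
    using assms(1) by (simp add: pos_le_divide_eq)
  then show ?thesis by (simp only: row_area_def le_floor_iff diff_ge_0_iff_ge)
qed

lemma area_above_Cons_right:
  assumes "\<beta> \<in> paths_from m n (u', v)"
  shows "area_above m n ((u, v) # \<beta>) = area_above m n \<beta>"
proof -
  obtain \<gamma> where \<beta>: "\<beta> = (u', v) # \<gamma>" using assms by (cases \<beta>) (auto simp: paths_from_def)
  then show ?thesis by (simp add: area_above_def row_start_Cons)
qed

lemma area_above_Cons_rise:
  assumes "\<beta> \<in> paths_from m n (u', Suc v)"
  shows "area_above m n ((u, v) # \<beta>) = row_area m n u v + area_above m n \<beta>"
proof -
  obtain \<gamma> where \<beta>: "\<beta> = (u', Suc v) # \<gamma>" using assms by (cases \<beta>) (auto simp: paths_from_def)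
  have "v < n" using paths_from_bounded [OF assms] by simp
  moreover have "row_start ((u, v) # \<beta>) v = u"
    using assms unfolding \<beta> by (intro row_start_first) (simp add: paths_from_def)
  ultimately show ?thesis
    by (simp add: area_above_def \<beta> row_start_Cons sum.atLeast_Suc_lessThan)
qed

lemma area_above_nonneg:
  "n > 0 \<Longrightarrow> \<alpha> \<in> paths_from m n P \<Longrightarrow> area_above m n \<alpha> \<ge> 0"
proof (induction \<alpha> arbitrary: P)
  case (Cons A \<beta>)
  show ?case
  proof (cases "A # \<beta> = [(m, n)]")
    case False
    then obtain Q where Q: "P = A" "weakly_above m n A" "lattice_step A Q" "\<beta> \<in> paths_from m n Q"
      using Cons.prems(2) unfolding paths_from_decompose [of _ m n P] by auto
    obtain u v where A: "A = (u, v)" by force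
    show ?thesis
      using Q Cons.IH [OF Cons.prems(1) Q(4)] row_area_nonneg [OF Cons.prems(1), of m u v]
      by (auto simp: A lattice_step_def area_above_Cons_right area_above_Cons_rise)
  qed (simp add: area_above_def)
qed (simp add: paths_from_def)

section \<open>Absorbing diagonal steps into risers\<close>

text \<open>
  Generic weights allow two instances: elementary symmetric functions with a formal variable \<open>y\<close>, and
  risers of weight \<open>1\<close>. The number \<open>c\<close> of pending up steps, those immediately before the path starts,
  makes the weight computable one step at a time although risers span several steps.
\<close>

definition path_weight ::
  "nat \<Rightarrow> nat \<Rightarrow> 'r \<Rightarrow> (nat \<Rightarrow> 'r) \<Rightarrow> 'r \<Rightarrow> nat \<Rightarrow> (nat \<times> nat) list \<Rightarrow> 'r::comm_ring_1" where
  "path_weight m n s f y c \<alpha> =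
     (\<Prod>k\<leftarrow>run_lengths (replicate c True @ map is_up (segments \<alpha>)). f k) *
     y ^ diag \<alpha> * s ^ nat (area_above m n \<alpha>)"

definition path_sum ::
  "nat \<Rightarrow> nat \<Rightarrow> 'r \<Rightarrow> (nat \<Rightarrow> 'r) \<Rightarrow> 'r \<Rightarrow> nat \<Rightarrow> nat \<times> nat \<Rightarrow> 'r::comm_ring_1" where
  "path_sum m n s f y c P = (\<Sum>\<alpha>\<in>paths_from m n P. path_weight m n s f y c \<alpha>)"

lemma path_weight_Cons_up:
  assumes "n > 0" "weakly_above m n (u, v)" "\<beta> \<in> paths_from m n (u, Suc v)"
  shows "path_weight m n s f y c ((u, v) # \<beta>) =
    s ^ nat (row_area m n u v) * path_weight m n s f y (Suc c) \<beta>"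
proof -
  obtain \<gamma> where \<beta>: "\<beta> = (u, Suc v) # \<gamma>" using assms(3) by (cases \<beta>) (auto simp: paths_from_def)
  show ?thesis
    using area_above_Cons_rise [OF assms(3), of u] area_above_nonneg [OF assms(1,3)]
      row_area_nonneg [OF assms(1,2)]
    by (simp add: path_weight_def \<beta> is_up_def is_diag_def diag_def nat_add_distrib power_add mult_ac)
qed

lemma path_weight_Cons_diag:
  assumes "n > 0" "weakly_above m n (u, v)" "\<beta> \<in> paths_from m n (Suc u, Suc v)" "f 0 = 1"
  shows "path_weight m n s f y c ((u, v) # \<beta>) =
    f c * y * s ^ nat (row_area m n u v) * path_weight m n s f y 0 \<beta>"
proof -
  obtain \<gamma> where \<beta>: "\<beta> = (Suc u, Suc v) # \<gamma>" using assms(3) by (cases \<beta>) (auto simp: paths_from_def)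
  show ?thesis
    using area_above_Cons_rise [OF assms(3), of u] area_above_nonneg [OF assms(1,3)]
      row_area_nonneg [OF assms(1,2)] assms(4)
    by (simp add: path_weight_def \<beta> is_up_def is_diag_def diag_def nat_add_distrib power_add mult_ac)
qed

lemma path_weight_Cons_right:
  assumes "\<beta> \<in> paths_from m n (Suc u, v)" "f 0 = 1"
  shows "path_weight m n s f y c ((u, v) # \<beta>) = f c * path_weight m n s f y 0 \<beta>"
proof -
  obtain \<gamma> where \<beta>: "\<beta> = (Suc u, v) # \<gamma>" using assms(1) by (cases \<beta>) (auto simp: paths_from_def)
  show ?thesis
    using area_above_Cons_right [OF assms(1), of u] assms(2)
    by (simp add: path_weight_def \<beta> is_up_def is_diag_def diag_def mult_ac)
qed

text \<open>
  A right or diagonal step closes the pending riser, at the price \<open>f c\<close>; an up step prolongs it. The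
  condition \<open>f 0 = 1\<close> lets the same rule cover the case that no riser is pending.
\<close>

lemma path_sum_step:
  assumes "n > 0" "f 0 = 1" "(u, v) \<noteq> (m, n)" "weakly_above m n (u, v)"
  shows "path_sum m n s f y c (u, v) =
    s ^ nat (row_area m n u v) * path_sum m n s f y (Suc c) (u, Suc v) +
    f c * y * s ^ nat (row_area m n u v) * path_sum m n s f y 0 (Suc u, Suc v) +
    f c * path_sum m n s f y 0 (Suc u, v)"
proof -
  let ?U = "paths_from m n (u, Suc v)" and ?D = "paths_from m n (Suc u, Suc v)"
    and ?R = "paths_from m n (Suc u, v)"
  have disj: "?U \<inter> ?D = {}" "(?U \<union> ?D) \<inter> ?R = {}" by (auto simp: paths_from_def)
  have "path_sum m n s f y c (u, v) =
      (\<Sum>\<beta>\<in>?U \<union> ?D \<union> ?R. path_weight m n s f y c ((u, v) # \<beta>))"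
    unfolding path_sum_def paths_from_step [OF assms(3,4)] by (subst sum.reindex) auto
  also have "\<dots> = (\<Sum>\<beta>\<in>?U. path_weight m n s f y c ((u, v) # \<beta>)) +
      (\<Sum>\<beta>\<in>?D. path_weight m n s f y c ((u, v) # \<beta>)) +
      (\<Sum>\<beta>\<in>?R. path_weight m n s f y c ((u, v) # \<beta>))"
    using disj by (simp add: sum.union_disjoint finite_paths_from)
  also have "\<dots> = s ^ nat (row_area m n u v) * path_sum m n s f y (Suc c) (u, Suc v) +
    f c * y * s ^ nat (row_area m n u v) * path_sum m n s f y 0 (Suc u, Suc v) +
    f c * path_sum m n s f y 0 (Suc u, v)"
    using assms unfolding path_sum_def sum_distrib_left
    by (intro arg_cong2 [of _ _ _ _ "(+)"] sum.cong refl)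
      (simp_all add: path_weight_Cons_up path_weight_Cons_diag path_weight_Cons_right)
  finally show ?thesis .
qed

text \<open>
  An up step followed by a right step may be merged into a diagonal step, which shortens the riser by
  one and costs \<open>y\<close>; this explains the weight \<open>f c + y f (c - 1)\<close> of a riser in a path without
  diagonal steps. If \<open>c\<close> up steps are pending at \<open>(u, v)\<close>, then the merging may concern the last of
  them, and the path continues from \<open>(u + 1, v)\<close> with the riser reduced to \<open>c - 1\<close>. The additional term
  accounts for these paths, which do not visit \<open>(u, v)\<close>. With it both sides obey the same recursion.
  At the endpoint no right step can follow, hence the restriction to \<open>c = 0\<close> there.
\<close>

lemma path_sum_absorb_diagonals:
  fixes f :: "nat \<Rightarrow> 'r::comm_ring_1" and s y :: 'r
  assumes "m > 0" "n > 0" "f 0 = 1" "(u, v) = (m, n) \<Longrightarrow> c = 0"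
  defines "g \<equiv> \<lambda>c. if c = 0 then 1 else f c + y * f (c - 1)"
  shows "path_sum m n s g 0 c (u, v) = path_sum m n s f y c (u, v) +
    (if c = 0 then 0 else y * f (c - 1) * path_sum m n s f y 0 (Suc u, v))"
  using assms(4)
proof (induction "(Suc m - u) + (Suc n - v)" arbitrary: u v c rule: less_induct)
  case less
  have g: "g 0 = 1" by (simp add: g_def)
  consider "(u, v) = (m, n)" | "\<not> (u \<le> m \<and> v \<le> n \<and> weakly_above m n (u, v))"
    | "u \<le> m" "v \<le> n" "(u, v) \<noteq> (m, n)" "weakly_above m n (u, v)"
    by blast
  then show ?case
  proof cases
    case 1
    then show ?thesis
      using less.prems by (simp add: path_sum_def path_weight_def paths_from_end diag_def area_above_def)
  next
    case 2
    then have "\<not> (Suc u \<le> m \<and> v \<le> n \<and> weakly_above m n (Suc u, v))"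
      by (auto simp: weakly_above_def algebra_simps)
    with 2 have "paths_from m n (u, v) = {}" "paths_from m n (Suc u, v) = {}"
      using paths_from_bounded paths_from_not_above by blast+
    then show ?thesis by (simp add: path_sum_def)
  next
    case 3
    let ?S = "s ^ nat (row_area m n u v)" and ?T = "path_sum m n s f y"
    \<comment> \<open>an up step into the endpoint would start strictly below the diagonal\<close>
    have "(u, Suc v) \<noteq> (m, n)"
      using 3(4) assms(1) by (auto simp: weakly_above_def algebra_simps)
    have decr: "(Suc m - u) + (Suc n - Suc v) < (Suc m - u) + (Suc n - v)"
      "(Suc m - Suc u) + (Suc n - v) < (Suc m - u) + (Suc n - v)"
      using 3(1,2) by arith+
    have up: "path_sum m n s g 0 (Suc c) (u, Suc v) =
        ?T (Suc c) (u, Suc v) + y * f c * ?T 0 (Suc u, Suc v)"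
      using less.hyps [OF decr(1), of "Suc c"] \<open>(u, Suc v) \<noteq> (m, n)\<close> by auto
    have right: "path_sum m n s g 0 0 (Suc u, v) = ?T 0 (Suc u, v)"
      using less.hyps [OF decr(2), of 0] by simp
    show ?thesis
      unfolding path_sum_step [of n g, OF assms(2) g 3(3,4)]
        path_sum_step [of n f, OF assms(2,3) 3(3,4)] up right
      using assms(3) by (simp add: g_def algebra_simps)
  qed
qed

text \<open>
  Weight \<open>0\<close> for diagonal steps selects the paths without them, so both sums are values of
  \<^const>\<open>path_sum\<close> at the origin, where no riser is pending.
\<close>

theorem schroeder_sum_eq_dyck_sum:
  fixes f :: "nat \<Rightarrow> 'r::comm_ring_1"
  assumes "m > 0" "n > 0" "f 0 = 1"
  shows "(\<Sum>\<alpha>\<in>schroeder_paths m n. (\<Prod>k\<leftarrow>risers \<alpha>. f k) * y ^ diag \<alpha> * s ^ nat (area m n \<alpha>)) =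
    (\<Sum>\<alpha> | \<alpha> \<in> schroeder_paths m n \<and> diag \<alpha> = 0.
       (\<Prod>k\<leftarrow>risers \<alpha>. f k + y * f (k - 1)) * s ^ nat (area m n \<alpha>))"
proof -
  define g where "g = (\<lambda>c. if c = 0 then 1 else f c + y * f (c - 1))"
  have fin: "finite (schroeder_paths m n)"
    by (simp add: schroeder_paths_eq finite_paths_from)
  have sum: "path_sum m n s f' y' 0 (0, 0) =
      (\<Sum>\<alpha>\<in>schroeder_paths m n. (\<Prod>k\<leftarrow>risers \<alpha>. f' k) * y' ^ diag \<alpha> * s ^ nat (area m n \<alpha>))" for f' y'
    unfolding path_sum_def schroeder_paths_eq
    by (intro sum.cong refl) (simp add: path_weight_def risers_def area_eq_area_above)
  have "(\<Sum>\<alpha>\<in>schroeder_paths m n. (\<Prod>k\<leftarrow>risers \<alpha>. f k) * y ^ diag \<alpha> * s ^ nat (area m n \<alpha>)) =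
      (\<Sum>\<alpha>\<in>schroeder_paths m n. (\<Prod>k\<leftarrow>risers \<alpha>. g k) * 0 ^ diag \<alpha> * s ^ nat (area m n \<alpha>))"
    using path_sum_absorb_diagonals [of m n f 0 0 0 s y] assms
    unfolding g_def [symmetric] sum by simp
  also have "\<dots> = (\<Sum>\<alpha> | \<alpha> \<in> schroeder_paths m n \<and> diag \<alpha> = 0.
      (\<Prod>k\<leftarrow>risers \<alpha>. g k) * s ^ nat (area m n \<alpha>))"
    using fin by (intro sum.mono_neutral_cong_right) (auto simp: power_0_left)
  also have "\<dots> = (\<Sum>\<alpha> | \<alpha> \<in> schroeder_paths m n \<and> diag \<alpha> = 0.
      (\<Prod>k\<leftarrow>risers \<alpha>. f k + y * f (k - 1)) * s ^ nat (area m n \<alpha>))"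
  proof -
    have "map g (risers \<alpha>) = map (\<lambda>k. f k + y * f (k - 1)) (risers \<alpha>)" for \<alpha>
      by (auto simp: g_def risers_def dest: run_lengths_pos)
    then show ?thesis by (simp only:)
  qed
  finally show ?thesis .
qed

text \<open>
  Each row is crossed by exactly one up or diagonal step.
\<close>

lemma rises_eq_height:
  "successively lattice_step \<alpha> \<Longrightarrow> \<alpha> \<noteq> [] \<Longrightarrow>
    snd (hd \<alpha>) + length (filter is_up (segments \<alpha>)) + diag \<alpha> = snd (last \<alpha>)"
  by (induction \<alpha> rule: induct_list012) (auto simp: lattice_step_def is_up_def is_diag_def diag_def)

lemma sum_list_risers:
  assumes "\<alpha> \<in> schroeder_paths m n"
  shows "sum_list (risers \<alpha>) + diag \<alpha> = n"
proof -
  have "sum_list (risers \<alpha>) = length (filter is_up (segments \<alpha>))"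
    by (simp add: risers_def sum_list_run_lengths filter_map comp_def)
  then show ?thesis
    using assms rises_eq_height [of \<alpha>] by (auto simp: schroeder_paths_eq paths_from_def)
qed

section \<open>Adding a variable\<close>

lemma coeff_add_variable:
  "coeff (symcoeff (add_variable f) M) j = symcoeff f (image_mset Suc M + replicate_mset j 0)"
proof -
  obtain d where d: "symcoeff f N \<noteq> 0 \<Longrightarrow> size N \<le> d" for N
    using symcoeff [of f] by auto
  have "symcoeff f (image_mset Suc M + replicate_mset j 0) = 0" if "j > d" for j
    using d [of "image_mset Suc M + replicate_mset j 0"] that by auto
  then show ?thesis
    unfolding add_variable.rep_eq by (subst coeff_Abs_poly [where n = d]) auto
qed

lemma symfun_poly_eqI:
  "(\<And>M j. coeff (symcoeff f M) j = coeff (symcoeff g M) j) \<Longrightarrow> f = g"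
  by (intro symfun_eqI poly_eqI)

lemma add_variable_0 [simp]: "add_variable 0 = 0"
  by (rule symfun_poly_eqI) (simp add: coeff_add_variable)

lemma add_variable_1 [simp]: "add_variable 1 = 1"
  by (rule symfun_poly_eqI) (auto simp: coeff_add_variable symcoeff_1)

lemma add_variable_add: "add_variable (f + g) = add_variable f + add_variable g"
  by (rule symfun_poly_eqI) (simp add: coeff_add_variable)

lemma add_variable_scale: "add_variable (scale c f) = scale (monom c 0) (add_variable f)"
  by (rule symfun_poly_eqI) (simp add: coeff_add_variable monom_0)

lemma add_variable_sum: "add_variable (\<Sum>x\<in>X. f x) = (\<Sum>x\<in>X. add_variable (f x))"
  by (induction X rule: infinite_finite_induct) (simp_all add: add_variable_add)

text \<open>
  Forgets the power of the new variable \<open>0\<close> in a monomial and renumbers the others. Together with the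
  exponent of variable \<open>0\<close> it recovers the monomial, which is what the product formula needs.
\<close>

definition drop_variable :: "nat multiset \<Rightarrow> nat multiset" where
  "drop_variable X = image_mset (\<lambda>i. i - 1) (filter_mset (\<lambda>i. i \<noteq> 0) X)"

lemma drop_variable_inverse: "image_mset Suc (drop_variable X) + replicate_mset (count X 0) 0 = X"
  by (induction X) (auto simp: drop_variable_def)

lemma drop_variable_add: "drop_variable (X + Y) = drop_variable X + drop_variable Y"
  by (simp add: drop_variable_def)

lemma drop_variable_shift [simp]:
  "drop_variable (image_mset Suc M + replicate_mset j 0) = M"
  by (simp add: drop_variable_def filter_mset_image_mset multiset.map_comp comp_def)

lemma count_shift_0 [simp]: "count (image_mset Suc M) 0 = 0"
  by (induction M) auto

lemma count_shift_Suc [simp]: "count (image_mset Suc M) (Suc i) = count M i"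
  by (induction M) auto

lemma all_nat_shift: "(\<forall>i. P i) \<longleftrightarrow> P 0 \<and> (\<forall>i. P (Suc i))" for P :: "nat \<Rightarrow> bool"
  by (metis not0_implies_Suc)

lemma add_variable_mult: "add_variable (f * g) = add_variable f * add_variable g"
proof (rule symfun_poly_eqI)
  fix M j
  let ?D = "\<lambda>M. {(A, B). A + B = (M :: nat multiset)}"
  let ?s = "\<lambda>A i. image_mset Suc A + replicate_mset i 0"
  let ?i = "\<lambda>((A, B), i). (?s A i, ?s B (j - i))"
  let ?j = "\<lambda>(X, Y). ((drop_variable X, drop_variable Y), count X 0)"
  let ?t = "\<lambda>((A, B), i). symcoeff f (?s A i) * symcoeff g (?s B (j - i))"
  have "coeff (symcoeff (add_variable (f * g)) M) j =
      (\<Sum>(X, Y)\<in>?D (?s M j). symcoeff f X * symcoeff g Y)"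
    by (simp add: coeff_add_variable symcoeff_mult)
  also have "\<dots> = (\<Sum>P\<in>?D M \<times> {..j}. ?t P)"
  proof (rule sum.reindex_bij_witness
      [where i = ?i
         and j = ?j])
    fix P assume "P \<in> ?D (?s M j)"
    then obtain X Y where P: "P = (X, Y)" "X + Y = ?s M j" by auto
    have 1: "drop_variable X + drop_variable Y = M"
      by (simp add: P(2) flip: drop_variable_add)
    have "count X 0 + count Y 0 = j"
      using arg_cong [OF P(2), of "\<lambda>Z. count Z 0"] by simp
    then have 2: "count X 0 \<le> j" "j - count X 0 = count Y 0" by auto
    show "?j P \<in> ?D M \<times> {..j}"
      using P 1 2 by simp
    show "?i (?j P) = P"
      using P 2 by (simp add: drop_variable_inverse)
    show "?t (?j P) = (case P of (X, Y) \<Rightarrow> symcoeff f X * symcoeff g Y)"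
      using P 2 by (simp add: drop_variable_inverse)
  next
    fix P assume "P \<in> ?D M \<times> {..j}"
    then obtain A B i where P: "P = ((A, B), i)" "A + B = M" "i \<le> j" by auto
    then have "replicate_mset i 0 + replicate_mset (j - i) 0 = replicate_mset j (0 :: nat)"
      by (simp add: multiset_eq_iff)
    with P show "?i P \<in> ?D (?s M j)"
      by (auto simp: ac_simps)
    show "?j (?i P) = P"
      using P by simp
  qed
  also have "\<dots> = coeff (symcoeff (add_variable f * add_variable g) M) j"
    by (simp add: symcoeff_mult coeff_sum coeff_mult coeff_add_variable case_prod_unfold
        sum.cartesian_product)
  finally show "coeff (symcoeff (add_variable (f * g)) M) j =
      coeff (symcoeff (add_variable f * add_variable g) M) j" .
qed

lemma add_variable_prod_list:
  "add_variable (\<Prod>k\<leftarrow>ks. f k) = (\<Prod>k\<leftarrow>ks. add_variable (f k))"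
  by (induction ks) (simp_all add: add_variable_mult)

text \<open>
  A squarefree monomial contains the new variable at most once.
\<close>

lemma add_variable_elementary:
  assumes "k > 0"
  shows "add_variable (elementary k) = elementary k + scale (monom 1 1) (elementary (k - 1))"
proof (rule symfun_poly_eqI)
  fix M j
  have *: "(\<forall>i. count (image_mset Suc M + replicate_mset j 0) i \<le> 1) \<longleftrightarrow>
      j \<le> 1 \<and> (\<forall>i. count M i \<le> 1)"
    by (subst all_nat_shift) simp
  consider "j = 0" | "j = 1" | "j > 1" by linarith
  then show "coeff (symcoeff (add_variable (elementary k)) M) j =
      coeff (symcoeff (elementary k + scale (monom 1 1) (elementary (k - 1))) M) j"
    unfolding coeff_add_variable symcoeff_elementary * symcoeff_add symcoeff_scale
    using assms by cases (auto simp: coeff_monom_mult)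
qed

section \<open>Schroeder paths and the two enumerators\<close>

theorem corollary5:
  fixes m n :: nat
  assumes "m > 0" and "n > 0"
  shows "schroeder_enum m n = add_variable (dyck_enum m n) \<and>
    (\<forall>k\<le>n. schroeder_diag_enum m n k =
       hall (dyck_enum m n) (elementary (n - k) * homogeneous k))"
proof (intro conjI allI impI)
  let ?y = "monom 1 1 :: rat poly poly" and ?q = "monom (monom 1 1) 0 :: rat poly poly"
  have monom_q_y: "?y ^ d * ?q ^ a = monom (monom 1 a) d" for d a
    by (simp add: monom_power mult_monom)
  have "schroeder_enum m n = (\<Sum>\<alpha>\<in>schroeder_paths m n. (\<Prod>k\<leftarrow>risers \<alpha>. elementary k) *
      scale ?y 1 ^ diag \<alpha> * scale ?q 1 ^ nat (area m n \<alpha>))"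
    by (simp add: schroeder_enum_def weight_def scale_power monom_q_y mult.commute
        del: One_nat_def)
  also have "\<dots> = (\<Sum>\<alpha> | \<alpha> \<in> schroeder_paths m n \<and> diag \<alpha> = 0.
      (\<Prod>k\<leftarrow>risers \<alpha>. elementary k + scale ?y 1 * elementary (k - 1)) * scale ?q 1 ^ nat (area m n \<alpha>))"
    by (rule schroeder_sum_eq_dyck_sum) (use assms in auto)
  also have "\<dots> = add_variable (dyck_enum m n)"
    unfolding dyck_enum_def weight_def add_variable_sum
  proof (intro sum.cong refl)
    fix \<alpha>
    have "map (\<lambda>k. elementary k + scale ?y 1 * elementary (k - 1)) (risers \<alpha>) =
        map (\<lambda>k. add_variable (elementary k)) (risers \<alpha>)"
      by (auto simp: add_variable_elementary risers_def dest: run_lengths_pos)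
    then have prod: "(\<Prod>k\<leftarrow>risers \<alpha>. elementary k + scale ?y 1 * elementary (k - 1)) =
        add_variable (\<Prod>k\<leftarrow>risers \<alpha>. elementary k)"
      by (simp only: add_variable_prod_list)
    show "(\<Prod>k\<leftarrow>risers \<alpha>. elementary k + scale ?y 1 * elementary (k - 1)) *
        scale ?q 1 ^ nat (area m n \<alpha>) =
        add_variable (scale (monom 1 (nat (area m n \<alpha>))) (\<Prod>k\<leftarrow>risers \<alpha>. elementary k))"
      unfolding prod by (simp add: add_variable_scale scale_power monom_power)
  qed
  finally show "schroeder_enum m n = add_variable (dyck_enum m n)" .

  fix k assume "k \<le> n"
  let ?Dyck = "{\<alpha> \<in> schroeder_paths m n. diag \<alpha> = 0}"
  let ?v = "\<Sum>\<alpha>\<in>?Dyck. smult (monom 1 (nat (area m n \<alpha>))) ((1 + ?y) ^ length (risers \<alpha>))"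
  have fin: "finite (schroeder_paths m n)"
    by (simp add: schroeder_paths_eq finite_paths_from)
  have q_power: "?q ^ a = [:monom 1 a:]" for a
    using monom_q_y [of 0 a] by (simp add: monom_0)
  have const_prod: "(\<Prod>k\<leftarrow>ks. c) = c ^ length ks" for ks :: "nat list" and c :: "rat poly poly"
    by (induction ks) simp_all
  \<comment> \<open>the pairing only sees the number of risers: each of them has the image \<open>1 + t\<close>\<close>
  have "specializes n (dyck_enum m n) ?v"
    unfolding dyck_enum_def
  proof (intro specializes_sum specializes_scale)
    fix \<alpha> assume "\<alpha> \<in> ?Dyck"
    then have "sum_list (risers \<alpha>) = n" using sum_list_risers by fastforce
    moreover have "specializes (sum_list (risers \<alpha>)) (weight \<alpha>) ((1 + ?y) ^ length (risers \<alpha>))"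
      unfolding weight_def
      by (rule specializes_elementary_prod) (auto simp: risers_def dest: run_lengths_pos)
    ultimately show "specializes n (weight \<alpha>) ((1 + ?y) ^ length (risers \<alpha>))" by simp
  qed
  then have "hall (dyck_enum m n) (elementary (n - k) * homogeneous k) = coeff ?v k"
    using hall_elem_hom [of n _ _ k] \<open>k \<le> n\<close> by (simp add: elem_hom_def)
  also have "?v = (\<Sum>\<alpha>\<in>?Dyck. (\<Prod>k\<leftarrow>risers \<alpha>. 1 + ?y * 1) * ?q ^ nat (area m n \<alpha>))"
    by (intro sum.cong refl) (simp add: const_prod q_power mult.commute del: One_nat_def)
  \<comment> \<open>the same factor \<open>1 + t\<close> arises from merging diagonal steps into risers of weight \<open>1\<close>\<close>
  also have "\<dots> = (\<Sum>\<alpha>\<in>schroeder_paths m n.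
      (\<Prod>k\<leftarrow>risers \<alpha>. 1) * ?y ^ diag \<alpha> * ?q ^ nat (area m n \<alpha>))"
    using schroeder_sum_eq_dyck_sum [OF assms, of "\<lambda>_. 1" ?y ?q] by simp
  also have "\<dots> = (\<Sum>\<alpha>\<in>schroeder_paths m n. monom (monom 1 (nat (area m n \<alpha>))) (diag \<alpha>))"
    by (simp add: const_prod monom_q_y del: One_nat_def)
  also have "coeff \<dots> k = (\<Sum>\<alpha>\<in>schroeder_paths m n.
      if diag \<alpha> = k then monom 1 (nat (area m n \<alpha>)) else 0)"
    by (simp add: coeff_sum)
  also have "\<dots> = schroeder_diag_enum m n k"
    unfolding schroeder_diag_enum_def using fin by (simp add: sum.If_cases Int_def conj_commute)
  finally show "schroeder_diag_enum m n k =
      hall (dyck_enum m n) (elementary (n - k) * homogeneous k)" ..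
qed

end
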